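(* Let $a=\{a_n\}_{n\ge1}$ be a non-increasing, summable sequence of positive real numbers, with associated Cantor set $C_a$. There exists a dimension function $h\in\mathcal{D}$ such that $C_a$ is $h$-regular. Moreover, the dimension functions $h\in\mathcal{D}$ for which $C_a$ is $h$-regular form an equivalence class of the relation $\equiv$ on $\mathcal{D}$, and for $h\in\mathcal{D}$, $C_a$ is $h$-regular if and only if $h$ is associated to $a$.
   Context: Dimension functions: a function $h$ on an interval $(0,A]$ is increasing if $h(x)<h(y)$ whenever $x<y$, and doubling if there is $\tau>0$ with $h(x)\ge\tau h(2x)$ for all $x$ with $x,2x$ in the domain. A dimension function is a continuous, increasing, doubling function $h:(0,A]\to(0,\infty)$ (for some $A>0$, which may depend on $h$) with $h(x)\to0$ as $x\to0^+$; put $h(0)=0$. $\mathcal{D}$ is the set of dimension functions. Measures: for $E\subseteq\mathbb{R}$, with $|B|$ the diameter of $B$, $H^h(E)=\lim_{\delta\to0^+}\inf\{\sum_i h(|E_i|): E\subseteq\bigcup_i E_i,\ |E_i|\le\delta\}$ (countable covers). A $\delta$-packing of $E$ is a disjoint family of open balls (open intervals) centered at points of $E$ with diameters less than $\delta$. The $h$-packing pre-measure is $P_0^h(E)=\lim_{\delta\to0^+}\sup\{\sum_i h(|B_i|):\{B_i\}\text{ a }\delta\text{-packing of }E\}$, and the $h$-packing measure is $P^h(E)=\inf\{\sum_{i=1}^\infty P_0^h(E_i): E=\bigcup_{i=1}^\infty E_i\}$. $E$ is $h$-regular if $0<H^h(E)\le P^h(E)<\infty$. Equivalence: $f\preceq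 h$ means there is $c>0$ with $f(x)\le c\,h(x)$ for all $x$ (in the common domain); $f\equiv h$ means $f\preceq h$ and $h\preceq f$. Positive sequences $x,y$ are equivalent if there are $c_1,c_2>0$ with $c_1\le x_n/y_n\le c_2$ for all $n$. The Cantor set $C_a$: for a positive, non-increasing, summable $a$, set $\ell_n=\sum_{k\ge0}\sum_{j=0}^{2^k-1}a_{2^kn+j}$, so $\ell_1=\sum_n a_n$ and $\ell_n=a_n+\ell_{2n}+\ell_{2n+1}$. Let $I_1$ be a closed interval of length $\ell_1$; given the closed interval $I_n$ of length $\ell_n$, remove from it an open interval of length $a_n$ so that the remaining left closed interval $I_{2n}$ has length $\ell_{2n}$ and the remaining right closed interval $I_{2n+1}$ has length $\ell_{2n+1}$. Then $C_a=\bigcap_{k\ge0}\bigcup_{n=2^k}^{2^{k+1}-1}I_n$. The tails are $r_n^{(a)}=\sum_{j\ge n}a_j$. Associated functions: an increasing continuous $h:(0,A]\to(0,\infty)$ is associated to $a$ if the sequence $\{h(r_n^{(a)}/n)\}$ (over those $n$ with $r_n^{(a)}/n\le A$) is equivalent to $\{1/n\}$. *)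

theory Defs
  imports "HOL-Analysis.Analysis"
begin

(* A function h on (0,A], extended by h(0) = 0, is the pair (A, h) with h extensional on {0..A};
   the domain is part of the data because A may depend on h. *)
type_synonym gauge = "real \<times> (real \<Rightarrow> real)"

definition inc_gauges :: "gauge set" where
  "inc_gauges = {(A, h). 0 < A \<and> h \<in> extensional {0..A} \<and> h 0 = 0 \<and>
     (\<forall>x\<in>{0<..A}. 0 < h x) \<and> continuous_on {0<..A} h \<and> strict_mono_on {0<..A} h}"

definition doubling :: "gauge \<Rightarrow> bool" where
  "doubling = (\<lambda>(A, h). \<exists>\<tau>>0. \<forall>x. 0 < x \<and> 2 * x \<le> A \<longrightarrow> h x \<ge> \<tau> * h (2 * x))"

definition dim_funs :: "gauge set" where
  "dim_funs = {(A, h) \<in> inc_gauges. doubling (A, h) \<and> (h \<longlongrightarrow> 0) (at_right 0)}"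

definition gauge_le :: "gauge \<Rightarrow> gauge \<Rightarrow> bool" where
  "gauge_le = (\<lambda>(A, f) (B, h). \<exists>c>0. \<forall>x. 0 < x \<and> x \<le> A \<and> x \<le> B \<longrightarrow> f x \<le> c * h x)"

definition dim_fun_equiv :: "gauge rel" where
  "dim_fun_equiv = {(f, h). f \<in> dim_funs \<and> h \<in> dim_funs \<and> gauge_le f h \<and> gauge_le h f}"

(* In the measures below only the values of h on some [0,A] with A > 0 matter, because of
   the limits at 0.  Covers consist of bounded sets since diameter is not meaningful otherwise. *)

definition hausdorff_meas :: "(real \<Rightarrow> real) \<Rightarrow> real set \<Rightarrow> ennreal" where
  "hausdorff_meas h E = Lim (at_right 0) (\<lambda>\<delta>.
     Inf {(\<Sum>i. ennreal (h (diameter (U i)))) | U :: nat \<Rightarrow> real set.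
            E \<subseteq> (\<Union>i. U i) \<and> (\<forall>i. bounded (U i) \<and> diameter (U i) \<le> \<delta>)})"

definition packings :: "real \<Rightarrow> real set \<Rightarrow> real set set set" where
  "packings \<delta> E = {\<B>. disjoint \<B> \<and> (\<forall>B\<in>\<B>. \<exists>x\<in>E. \<exists>r>0. B = ball x r \<and> diameter B < \<delta>)}"

definition packing_premeas :: "(real \<Rightarrow> real) \<Rightarrow> real set \<Rightarrow> ennreal" where
  "packing_premeas h E = Lim (at_right 0) (\<lambda>\<delta>.
     SUP \<B>\<in>packings \<delta> E. \<Sum>\<^sub>\<infinity>B\<in>\<B>. ennreal (h (diameter B)))"

definition packing_meas :: "(real \<Rightarrow> real) \<Rightarrow> real set \<Rightarrow> ennreal" where
  "packing_meas h E = Inf {(\<Sum>i. packing_premeas h (F i)) | F :: nat \<Rightarrow> real set. E = (\<Union>i. F i)}"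

definition h_regular :: "gauge \<Rightarrow> real set \<Rightarrow> bool" where
  "h_regular = (\<lambda>(A, h) E. 0 < hausdorff_meas h E \<and> hausdorff_meas h E \<le> packing_meas h E \<and>
     packing_meas h E < \<infinity>)"

(* Sequences are indexed by n \<ge> 1; the value a 0 is never used. *)

definition cantor_length :: "(nat \<Rightarrow> real) \<Rightarrow> nat \<Rightarrow> real" where
  "cantor_length a n = (\<Sum>k. \<Sum>j<2 ^ k. a (2 ^ k * n + j))"

(* Left endpoint of the n-th interval, where x0 is the (arbitrary) left endpoint of the first. *)
fun cantor_left :: "(nat \<Rightarrow> real) \<Rightarrow> real \<Rightarrow> nat \<Rightarrow> real" where
  "cantor_left a x0 n =
     (if n \<le> 1 then x0
      else let m = n div 2 in
        if even n then cantor_left a x0 m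
        else cantor_left a x0 m + cantor_length a (2 * m) + a m)"

declare cantor_left.simps [simp del]

definition cantor_interval :: "(nat \<Rightarrow> real) \<Rightarrow> real \<Rightarrow> nat \<Rightarrow> real set" where
  "cantor_interval a x0 n = {cantor_left a x0 n .. cantor_left a x0 n + cantor_length a n}"

definition cantor_set :: "(nat \<Rightarrow> real) \<Rightarrow> real \<Rightarrow> real set" where
  "cantor_set a x0 = (\<Inter>k. \<Union>n\<in>{2 ^ k..<2 ^ (k + 1)}. cantor_interval a x0 n)"

definition seq_tail :: "(nat \<Rightarrow> real) \<Rightarrow> nat \<Rightarrow> real" where
  "seq_tail a n = (\<Sum>j. a (n + j))"

definition seq_equiv_on :: "nat set \<Rightarrow> (nat \<Rightarrow> real) \<Rightarrow> (nat \<Rightarrow> real) \<Rightarrow> bool" where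
  "seq_equiv_on N x y \<longleftrightarrow> (\<exists>c1>0. \<exists>c2>0. \<forall>n\<in>N. c1 \<le> x n / y n \<and> x n / y n \<le> c2)"

definition associated :: "gauge \<Rightarrow> (nat \<Rightarrow> real) \<Rightarrow> bool" where
  "associated = (\<lambda>(A, h) a. (A, h) \<in> inc_gauges \<and>
     seq_equiv_on {n. 1 \<le> n \<and> seq_tail a n / real n \<le> A} (\<lambda>n. h (seq_tail a n / real n)) (\<lambda>n. 1 / real n))"

lemma gauge_le_trans:
  assumes f: "f \<in> dim_funs" and g: "g \<in> dim_funs" and h: "h \<in> dim_funs"
    and fg: "gauge_le f g" and gh: "gauge_le g h"
  shows "gauge_le f h"
proof -
  obtain A f' B g' C h' where eq: "f = (A, f')" "g = (B, g')" "h = (C, h')"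
    by (metis surj_pair)
  have pos: "0 < A" "0 < B" "0 < C"
    and fp: "\<And>x. \<lbrakk>0 < x; x \<le> A\<rbrakk> \<Longrightarrow> 0 < f' x" and hp: "\<And>x. \<lbrakk>0 < x; x \<le> C\<rbrakk> \<Longrightarrow> 0 < h' x"
    and fm: "\<And>x y. \<lbrakk>0 < x; x < y; y \<le> A\<rbrakk> \<Longrightarrow> f' x < f' y"
    and hm: "\<And>x y. \<lbrakk>0 < x; x < y; y \<le> C\<rbrakk> \<Longrightarrow> h' x < h' y"
    using f g h by (auto simp: eq dim_funs_def inc_gauges_def strict_mono_on_def)
  obtain c where c: "c > 0" "\<And>x. \<lbrakk>0 < x; x \<le> A; x \<le> B\<rbrakk> \<Longrightarrow> f' x \<le> c * g' x"
    using fg by (auto simp: eq gauge_le_def)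
  obtain d where d: "d > 0" "\<And>x. \<lbrakk>0 < x; x \<le> B; x \<le> C\<rbrakk> \<Longrightarrow> g' x \<le> d * h' x"
    using gh by (auto simp: eq gauge_le_def)
  define m where "m = Min {A, B, C}"
  have m: "0 < m" "m \<le> A" "m \<le> B" "m \<le> C" and mB: "m = B \<or> m = A \<or> m = C"
    using pos by (auto simp: m_def min_def)
  define e where "e = c * d + f' A / h' m"
  have q: "f' A / h' m > 0"
    using fp[of A] hp[of m] pos m by auto
  have cd: "c * d > 0" using c d by auto
  have "e > 0" using q cd by (simp add: e_def)
  moreover have "f' x \<le> e * h' x" if x: "0 < x" "x \<le> A" "x \<le> C" for x
  proof (cases "x \<le> B")
    case True
    have "f' x \<le> c * g' x" using c x True by blast
    also have "\<dots> \<le> c * (d * h' x)" using c d x True by (intro mult_left_mono) auto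
    also have "\<dots> \<le> e * h' x"
      using mult_pos_pos[OF q hp[of x]] x by (simp add: e_def algebra_simps)
    finally show ?thesis .
  next
    case False
    then have "h' m \<le> h' x"
      using hm[of m x] m x by force
    have "f' x \<le> f' A" using fm[of x A] x by force
    also have "\<dots> = (f' A / h' m) * h' m" using hp[of m] m by simp
    also have "\<dots> \<le> (f' A / h' m) * h' x"
      using q \<open>h' m \<le> h' x\<close> by (intro mult_left_mono) auto
    also have "\<dots> \<le> e * h' x"
      using cd hp[of x] x by (intro mult_right_mono) (auto simp: e_def)
    finally show ?thesis .
  qed
  ultimately show ?thesis by (auto simp: eq gauge_le_def)
qed

lemma equiv_dim_fun_equiv: "equiv dim_funs dim_fun_equiv"
proof (rule equivI)
  show "dim_fun_equiv \<subseteq> dim_funs \<times> dim_funs" by (auto simp: dim_fun_equiv_def)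
  show "refl_on dim_funs dim_fun_equiv"
    by (auto simp: refl_on_def dim_fun_equiv_def gauge_le_def intro!: exI[of _ 1])
  show "sym dim_fun_equiv" by (auto simp: sym_def dim_fun_equiv_def)
  show "trans dim_fun_equiv"
    unfolding trans_def dim_fun_equiv_def by (blast intro: gauge_le_trans)
qed

lemma cantor_length_rec:
  assumes pos: "\<And>n. 1 \<le> n \<Longrightarrow> 0 < a n" and "summable a" and n: "1 \<le> n"
  shows "cantor_length a n = a n + cantor_length a (2 * n) + cantor_length a (2 * n + 1)"
proof -
  define S where "S n k = (\<Sum>j<2 ^ k. a (2 ^ k * n + j))" for n k :: nat
  have S_shift: "S n k = sum a {2 ^ k * n..<2 ^ k * n + 2 ^ k}" for n k
    unfolding S_def
    using sum.shift_bounds_nat_ivl[of a 0 "2 ^ k * n" "2 ^ k"]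
    by (simp add: atLeast0LessThan add.commute)
  have S_nonneg: "0 \<le> S n k" if "1 \<le> n" for n k
    unfolding S_def using that by (intro sum_nonneg less_imp_le[OF pos]) (simp add: trans_le_add1)
  have partial: "(\<Sum>k<K. S n k) \<le> sum a {1..<2 ^ K * n}" if n: "1 \<le> n" for n K
  proof (induction K)
    case 0
    show ?case using n by (auto intro!: sum_nonneg less_imp_le[OF pos])
  next
    case (Suc K)
    have "S n K \<le> sum a {2 ^ K * n..<2 ^ Suc K * n}"
      unfolding S_shift
    proof (rule sum_mono2)
      show "{2 ^ K * n..<2 ^ K * n + 2 ^ K} \<subseteq> {2 ^ K * n..<2 ^ Suc K * n}"
        using n by (auto intro: order.strict_trans2)
      show "0 \<le> a b" if "b \<in> {2 ^ K * n..<2 ^ Suc K * n} - {2 ^ K * n..<2 ^ K * n + 2 ^ K}" for b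
        using that n by (intro less_imp_le[OF pos]) (auto intro: order_trans)
    qed simp
    moreover have "sum a {1..<2 ^ Suc K * n} = sum a {1..<2 ^ K * n} + sum a {2 ^ K * n..<2 ^ Suc K * n}"
      using n by (intro sum.atLeastLessThan_concat[symmetric]) auto
    ultimately show ?case using Suc by simp
  qed
  have summ: "summable (S n)" if n: "1 \<le> n" for n
  proof (rule bounded_imp_summable)
    show "0 \<le> S n k" for k using S_nonneg n .
    have s1: "summable (\<lambda>i. a (Suc i))" using \<open>summable a\<close> by (simp add: summable_Suc_iff)
    show "sum (S n) {..K} \<le> (\<Sum>i. a (Suc i))" for K
    proof -
      have "sum (S n) {..K} = sum (S n) {..<Suc K}" by (simp only: lessThan_Suc_atMost)
      also have "\<dots> \<le> sum a {1..<2 ^ Suc K * n}" by (rule partial[OF n])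
      also have "\<dots> = (\<Sum>i<2 ^ Suc K * n - 1. a (Suc i))"
        using sum.shift_bounds_Suc_ivl[of a 0 "2 ^ Suc K * n - 1"] n
        by (simp add: atLeast0LessThan)
      also have "\<dots> \<le> (\<Sum>i. a (Suc i))"
        by (rule sum_le_suminf[OF s1]) (auto intro: less_imp_le[OF pos])
      finally show ?thesis .
    qed
  qed
  have split: "S n (Suc k) = S (2 * n) k + S (2 * n + 1) k" for k
  proof -
    have "sum a {2 ^ k * (2 * n)..<2 ^ k * (2 * n) + 2 ^ k}
        + sum a {2 ^ k * (2 * n) + 2 ^ k..<2 ^ k * (2 * n) + 2 ^ k + 2 ^ k}
        = sum a {2 ^ k * (2 * n)..<2 ^ k * (2 * n) + 2 ^ k + 2 ^ k}"
      by (intro sum.atLeastLessThan_concat) auto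
    then show ?thesis by (simp add: S_shift algebra_simps)
  qed
  have len: "cantor_length a n = suminf (S n)" for n
    unfolding cantor_length_def S_def ..
  have "cantor_length a n = suminf (S n)" by (rule len)
  also have "\<dots> = S n 0 + (\<Sum>k. S n (Suc k))"
    using suminf_split_head[OF summ[OF n]] by simp
  also have "(\<Sum>k. S n (Suc k)) = suminf (S (2 * n)) + suminf (S (2 * n + 1))"
    unfolding split using n by (intro suminf_add[symmetric] summ) auto
  finally show ?thesis by (simp add: len S_shift)
qed

lemma cantor_interval_split:
  fixes a :: "nat \<Rightarrow> real" and x0 :: real
  assumes "\<And>n. 1 \<le> n \<Longrightarrow> 0 < a n" and "summable a" and n: "1 \<le> n"
  defines "u \<equiv> cantor_left a x0 n + cantor_length a (2 * n)"
  shows "cantor_interval a x0 (2 * n) = {cantor_left a x0 n..u}"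
    and "cantor_interval a x0 (2 * n + 1) =
           {u + a n..cantor_left a x0 n + cantor_length a n}"
  using n cantor_length_rec[of a n] assms(1,2)
  by (auto simp: cantor_interval_def u_def cantor_left.simps[of a x0 "2 * n"]
      cantor_left.simps[of a x0 "Suc (2 * n)"])

end

theory Submission
  imports Defs
begin

text \<open>
  Write \<open>s k = r\<^bsub>2^k\<^esub> / 2^k\<close>. The lengths \<open>\<ell>\<^bsub>n\<^esub>\<close> are non-increasing and those of level \<open>k\<close> add up to
  \<open>r\<^bsub>2^k\<^esub>\<close>, so every interval of level \<open>k\<close> has length between \<open>s (k+1)\<close> and \<open>s (k-1)\<close>: up to one
  level the \<open>2^k\<close> intervals of level \<open>k\<close> all have size \<open>s k\<close>. Being associated to \<open>a\<close> means that
  \<open>2^k h (s k)\<close> is bounded above and away from 0.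

  The lower bound is equivalent to positive Hausdorff measure: covering by a whole level shows
  that it is necessary, and counting left endpoints in a finite cover shows that it suffices.
  The upper bound is equivalent to finite packing measure: counting left endpoints in disjoint
  balls shows that it suffices; conversely Baire's theorem yields a piece of finite premeasure that
  is dense in some \<open>C \<inter> I\<^bsub>n\<^esub>\<close>, and balls of radius \<open>s k / 4\<close> centred near left endpoints form a packing.
  Finally \<open>\<Sum>\<^bsub>k\<^esub> 2^-k min 1 ((x / s k)^2)\<close> is an associated dimension function.
\<close>

section \<open>Covering and packing contents\<close>

text \<open>The quantity at fixed \<delta> under the limit in \<open>hausdorff_meas\<close>.
  Together with \<open>packing_content\<close> it lets the limits be traded for a supremum and an
  infimum.\<close>

definition hausdorff_content :: "(real \<Rightarrow> real) \<Rightarrow> real \<Rightarrow> real set \<Rightarrow> ennreal" where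
  "hausdorff_content h \<delta> E =
     Inf {(\<Sum>i. ennreal (h (diameter (U i)))) | U :: nat \<Rightarrow> real set.
            E \<subseteq> (\<Union>i. U i) \<and> (\<forall>i. bounded (U i) \<and> diameter (U i) \<le> \<delta>)}"

definition packing_content :: "(real \<Rightarrow> real) \<Rightarrow> real \<Rightarrow> real set \<Rightarrow> ennreal" where
  "packing_content h \<delta> E =
     (SUP \<B>\<in>packings \<delta> E. \<Sum>\<^sub>\<infinity>B\<in>\<B>. ennreal (h (diameter B)))"

lemma hausdorff_content_antimono: "\<delta> \<le> \<epsilon> \<Longrightarrow> hausdorff_content h \<epsilon> E \<le> hausdorff_content h \<delta> E"
  unfolding hausdorff_content_def by (rule Inf_superset_mono) (blast intro: order_trans)

lemma packing_content_mono: "\<delta> \<le> \<epsilon> \<Longrightarrow> packing_content h \<delta> E \<le> packing_content h \<epsilon> E"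
  unfolding packing_content_def
  by (rule SUP_subset_mono) (fastforce simp: packings_def)+

text \<open>Fewer covers are admissible as \<delta> shrinks, so the contents increase and converge
  to their supremum. Convergence has to be shown before \<open>Lim\<close> can be evaluated.\<close>

lemma hausdorff_meas_eq_SUP: "hausdorff_meas h E = (SUP \<delta>\<in>{0<..}. hausdorff_content h \<delta> E)"
proof -
  have "((\<lambda>\<delta>. hausdorff_content h \<delta> E) \<longlongrightarrow> (SUP \<delta>\<in>{0<..}. hausdorff_content h \<delta> E)) (at_right 0)"
  proof (rule increasing_tendsto)
    show "\<forall>\<^sub>F \<delta> in at_right 0. hausdorff_content h \<delta> E \<le> (SUP \<delta>\<in>{0<..}. hausdorff_content h \<delta> E)"
      by (auto simp: eventually_at_right_field intro!: exI[of _ 1] SUP_upper)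
    fix y assume "y < (SUP \<delta>\<in>{0<..}. hausdorff_content h \<delta> E)"
    then obtain \<delta> where "\<delta> > 0" "y < hausdorff_content h \<delta> E" by (auto simp: less_SUP_iff)
    then show "\<forall>\<^sub>F \<delta> in at_right 0. y < hausdorff_content h \<delta> E"
      unfolding eventually_at_right_field
      by (meson hausdorff_content_antimono less_imp_le order_less_le_trans)
  qed
  then show ?thesis
    unfolding hausdorff_meas_def hausdorff_content_def[abs_def]
    by (intro tendsto_Lim) auto
qed

text \<open>Dual to the Hausdorff case: fewer packings are admissible as \<delta> shrinks, so the
  contents decrease to their infimum.\<close>

lemma packing_premeas_eq_INF: "packing_premeas h E = (INF \<delta>\<in>{0<..}. packing_content h \<delta> E)"
proof -
  have "((\<lambda>\<delta>. packing_content h \<delta> E) \<longlongrightarrow> (INF \<delta>\<in>{0<..}. packing_content h \<delta> E)) (at_right 0)"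
  proof (rule decreasing_tendsto)
    show "\<forall>\<^sub>F \<delta> in at_right 0. (INF \<delta>\<in>{0<..}. packing_content h \<delta> E) \<le> packing_content h \<delta> E"
      by (auto simp: eventually_at_right_field intro!: exI[of _ 1] INF_lower)
    fix y assume "(INF \<delta>\<in>{0<..}. packing_content h \<delta> E) < y"
    then obtain \<delta> where "\<delta> > 0" "packing_content h \<delta> E < y" by (auto simp: INF_less_iff)
    then show "\<forall>\<^sub>F \<delta> in at_right 0. packing_content h \<delta> E < y"
      unfolding eventually_at_right_field
      by (meson packing_content_mono less_imp_le order_le_less_trans)
  qed
  then show ?thesis
    unfolding packing_premeas_def packing_content_def[abs_def]
    by (intro tendsto_Lim) auto
qed

section \<open>Unordered sums in \<open>ennreal\<close> and countable subadditivity\<close>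

lemma infsum_ennreal_nat: "infsum f (UNIV :: nat set) = (\<Sum>i. f i)" for f :: "nat \<Rightarrow> ennreal"
proof -
  have "(f has_sum infsum f UNIV) UNIV"
    by (intro has_sum_infsum nonneg_summable_on_complete) auto
  then show ?thesis using has_sum_imp_sums sums_unique by blast
qed

lemma infsum_ennreal_split_finite:
  fixes f :: "'i \<Rightarrow> ennreal"
  assumes "finite F" "F \<subseteq> I"
  shows "infsum f I = sum f F + infsum f (I - F)"
proof -
  have "infsum f (F \<union> (I - F)) = infsum f F + infsum f (I - F)"
    by (intro infsum_Un_disjoint nonneg_summable_on_complete) auto
  then show ?thesis using assms by (simp add: Un_absorb1)
qed

lemma infsum_ennreal_cmult: "(\<Sum>\<^sub>\<infinity>i\<in>I. c * f i) = c * infsum f I" for f :: "'i \<Rightarrow> ennreal"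
proof -
  have "(\<Sum>\<^sub>\<infinity>i\<in>I. c * f i) = (SUP F\<in>{F. finite F \<and> F \<subseteq> I}. (\<Sum>i\<in>F. c * f i))"
    by (rule nonneg_infsum_complete) auto
  also have "\<dots> = c * (SUP F\<in>{F. finite F \<and> F \<subseteq> I}. (\<Sum>i\<in>F. f i))"
    unfolding sum_distrib_left[symmetric] by (rule SUP_mult_left_ennreal[symmetric])
  also have "(SUP F\<in>{F. finite F \<and> F \<subseteq> I}. (\<Sum>i\<in>F. f i)) = infsum f I"
    by (rule nonneg_infsum_complete[symmetric]) auto
  finally show ?thesis .
qed

lemma hausdorff_content_le_infsum:
  assumes "countable I" "h 0 = 0" "0 \<le> \<delta>" "E \<subseteq> (\<Union>i\<in>I. V i)"
    and "\<And>i. i \<in> I \<Longrightarrow> bounded (V i) \<and> diameter (V i) \<le> \<delta>"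
  shows "hausdorff_content h \<delta> E \<le> (\<Sum>\<^sub>\<infinity>i\<in>I. ennreal (h (diameter (V i))))"
proof -
  let ?e = "to_nat_on I"
  define U where "U n = (if n \<in> ?e ` I then V (from_nat_into I n) else {})" for n
  have inj: "inj_on ?e I" using assms(1) by (rule inj_on_to_nat_on)
  have U: "U (?e i) = V i" if "i \<in> I" for i
    using that assms(1) by (auto simp: U_def)
  have "(\<Sum>i. ennreal (h (diameter (U i)))) = (\<Sum>\<^sub>\<infinity>n\<in>?e ` I. ennreal (h (diameter (U n))))"
    unfolding infsum_ennreal_nat[symmetric] by (rule infsum_cong_neutral) (auto simp: U_def assms(2))
  also have "\<dots> = (\<Sum>\<^sub>\<infinity>i\<in>I. ennreal (h (diameter (V i))))"
    unfolding infsum_reindex[OF inj] by (rule infsum_cong) (simp add: U)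
  finally have eq: "(\<Sum>i. ennreal (h (diameter (U i)))) = (\<Sum>\<^sub>\<infinity>i\<in>I. ennreal (h (diameter (V i))))" .
  have "E \<subseteq> (\<Union>i. U i)" using assms(4) U by blast
  moreover have "bounded (U n) \<and> diameter (U n) \<le> \<delta>" for n
    using assms U by (cases "n \<in> ?e ` I") (auto simp: U_def)
  ultimately show ?thesis
    unfolding hausdorff_content_def eq[symmetric] by (intro Inf_lower) blast
qed

lemma hausdorff_content_le_sum:
  assumes "finite I" "h 0 = 0" "0 \<le> \<delta>" "E \<subseteq> (\<Union>i\<in>I. V i)"
    and "\<And>i. i \<in> I \<Longrightarrow> bounded (V i) \<and> diameter (V i) \<le> \<delta>"
  shows "hausdorff_content h \<delta> E \<le> (\<Sum>i\<in>I. ennreal (h (diameter (V i))))"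
  using hausdorff_content_le_infsum[of I h \<delta> E V] assms by (simp add: countable_finite)

text \<open>Choose for each \<open>F i\<close> a cover that is optimal up to e/2^(i+1), and merge
  the covers into one sequence.\<close>

lemma hausdorff_content_Union:
  assumes h0: "h 0 = 0" and \<delta>: "0 \<le> \<delta>"
  shows "hausdorff_content h \<delta> (\<Union>i. F i) \<le> (\<Sum>i. hausdorff_content h \<delta> (F i))"
proof (rule ennreal_le_epsilon)
  fix e :: real assume fin: "(\<Sum>i. hausdorff_content h \<delta> (F i)) < top" and "0 < e"
  have "\<exists>U. F i \<subseteq> (\<Union>j::nat. U j) \<and> (\<forall>j. bounded (U j) \<and> diameter (U j) \<le> \<delta>) \<and>
     (\<Sum>j. ennreal (h (diameter (U j)))) \<le> hausdorff_content h \<delta> (F i) + ennreal (e * (1/2) ^ Suc i)" for i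
  proof -
    \<comment> \<open>In \<open>ennreal\<close> adding a positive amount is a strict increase only
      for finite values; finiteness is inherited from the total.\<close>
    have "hausdorff_content h \<delta> (F i) \<noteq> \<infinity>"
      using fin by (metis ennreal_suminf_lessD infinity_ennreal_def less_irrefl)
    then obtain s where "s \<in> {(\<Sum>i. ennreal (h (diameter (U i)))) | U :: nat \<Rightarrow> real set.
            F i \<subseteq> (\<Union>i. U i) \<and> (\<forall>i. bounded (U i) \<and> diameter (U i) \<le> \<delta>)}"
         "s < hausdorff_content h \<delta> (F i) + ennreal (e * (1/2) ^ Suc i)"
    proof -
      have "hausdorff_content h \<delta> (F i) < hausdorff_content h \<delta> (F i) + ennreal (e * (1/2) ^ Suc i)"
        using \<open>hausdorff_content h \<delta> (F i) \<noteq> \<infinity>\<close> \<open>0 < e\<close>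
        using ennreal_add_left_cancel_less[of "hausdorff_content h \<delta> (F i)" 0 "ennreal (e * (1/2) ^ Suc i)"]
        by simp
      then show ?thesis using that
        unfolding hausdorff_content_def Inf_less_iff by blast
    qed
    then show ?thesis by (auto intro: less_imp_le)
  qed
  then obtain U where U: "\<And>i. F i \<subseteq> (\<Union>j::nat. U i j)" "\<And>i j. bounded (U i j) \<and> diameter (U i j) \<le> \<delta>"
     "\<And>i. (\<Sum>j. ennreal (h (diameter (U i j)))) \<le> hausdorff_content h \<delta> (F i) + ennreal (e * (1/2) ^ Suc i)"
    by metis
  have geo: "(\<Sum>i. ennreal (e * (1/2) ^ Suc i)) = ennreal e"
  proof (rule suminf_ennreal_eq)
    show "(\<lambda>i. e * (1/2) ^ Suc i) sums e"
      using sums_mult[OF power_half_series, of e] by simp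
  qed (use \<open>0 < e\<close> in auto)
  \<comment> \<open>The double family of covering sets is listed as one sequence by the pairing
    function.\<close>
  define W where "W n = (case prod_decode n of (i, j) \<Rightarrow> U i j)" for n
  have "hausdorff_content h \<delta> (\<Union>i. F i) \<le> (\<Sum>\<^sub>\<infinity>n\<in>UNIV. ennreal (h (diameter (W n))))"
  proof (rule hausdorff_content_le_infsum)
    show "(\<Union>i. F i) \<subseteq> (\<Union>n\<in>UNIV. W n)"
    proof
      fix x assume "x \<in> (\<Union>i. F i)"
      then obtain i j where "x \<in> U i j" using U(1) by blast
      then have "x \<in> W (prod_encode (i, j))" by (simp add: W_def)
      then show "x \<in> (\<Union>n\<in>UNIV. W n)" by blast
    qed
  qed (use U h0 \<delta> in \<open>auto simp: W_def split: prod.split\<close>)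
  also have "\<dots> = (\<Sum>i. \<Sum>j. ennreal (h (diameter (U i j))))"
    unfolding infsum_ennreal_nat
    using suminf_ennreal_2dimen[where f = "\<lambda>(i, j). ennreal (h (diameter (U i j)))"]
    by (simp add: W_def case_prod_beta)
  also have "\<dots> \<le> (\<Sum>i. hausdorff_content h \<delta> (F i) + ennreal (e * (1/2) ^ Suc i))"
    by (intro suminf_le U) auto
  also have "\<dots> = (\<Sum>i. hausdorff_content h \<delta> (F i)) + ennreal e"
    unfolding geo[symmetric] by (rule suminf_add[symmetric]) auto
  finally show "hausdorff_content h \<delta> (\<Union>i. F i) \<le> (\<Sum>i. hausdorff_content h \<delta> (F i)) + ennreal e" .
qed

lemma hausdorff_meas_Union:
  assumes "h 0 = 0"
  shows "hausdorff_meas h (\<Union>i. F i) \<le> (\<Sum>i. hausdorff_meas h (F i))"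
  unfolding hausdorff_meas_eq_SUP
proof (rule SUP_least)
  fix \<delta> :: real assume "\<delta> \<in> {0<..}"
  then have "hausdorff_content h \<delta> (\<Union>i. F i) \<le> (\<Sum>i. hausdorff_content h \<delta> (F i))"
    by (intro hausdorff_content_Union assms) auto
  also have "\<dots> \<le> (\<Sum>i. SUP \<delta>\<in>{0<..}. hausdorff_content h \<delta> (F i))"
    using \<open>\<delta> \<in> {0<..}\<close> by (intro suminf_le SUP_upper) auto
  finally show "hausdorff_content h \<delta> (\<Union>i. F i) \<le> \<dots>" .
qed

section \<open>Dimension functions and the comparison of Hausdorff and packing measures\<close>

lemma dim_funsD:
  assumes "(A, h) \<in> dim_funs"
  shows "0 < A" "h 0 = 0" "\<And>x. 0 < x \<Longrightarrow> x \<le> A \<Longrightarrow> 0 < h x"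
    "\<And>x y. 0 \<le> x \<Longrightarrow> x \<le> y \<Longrightarrow> y \<le> A \<Longrightarrow> h x \<le> h y"
    "continuous_on {0<..A} h" "(h \<longlongrightarrow> 0) (at_right 0)" "doubling (A, h)" "(A, h) \<in> inc_gauges"
proof -
  show *: "0 < A" "h 0 = 0" "\<And>x. 0 < x \<Longrightarrow> x \<le> A \<Longrightarrow> 0 < h x"
    "continuous_on {0<..A} h" "(h \<longlongrightarrow> 0) (at_right 0)" "doubling (A, h)" "(A, h) \<in> inc_gauges"
    using assms by (auto simp: dim_funs_def inc_gauges_def)
  have sm: "strict_mono_on {0<..A} h"
    using assms by (auto simp: dim_funs_def inc_gauges_def)
  \<comment> \<open>Monotonicity is extended to the argument 0, because covering sets may have
    diameter 0.\<close>
  show "h x \<le> h y" if "0 \<le> x" "x \<le> y" "y \<le> A" for x y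
  proof (cases "x = 0 \<or> x = y")
    case True
    then show ?thesis using *(2,3)[of] *(3)[of y] that by (cases "y = 0") (auto intro: less_imp_le)
  next
    case False
    then show ?thesis using that strict_mono_onD[OF sm, of x y] by simp
  qed
qed

lemma doublingE:
  assumes "(A, h) \<in> dim_funs"
  obtains c where "c > 0" "\<And>x. 0 < x \<Longrightarrow> 2 * x \<le> A \<Longrightarrow> h (2 * x) \<le> c * h x"
proof -
  obtain \<tau> where "\<tau> > 0" "\<And>x. 0 < x \<and> 2 * x \<le> A \<Longrightarrow> h x \<ge> \<tau> * h (2 * x)"
    using dim_funsD(7)[OF assms] by (auto simp: doubling_def)
  then show ?thesis
    by (intro that[of "1 / \<tau>"]) (auto simp: field_simps)
qed

text \<open>By the Vitali covering lemma, a maximal fine packing covers \<open>E\<close> once all but finitely many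
  of its balls are enlarged by a factor 5; doubling makes the cost of the enlarged tail negligible.\<close>

lemma hausdorff_content_le_packing_content:
  assumes D: "(A, h) \<in> dim_funs" and \<delta>: "0 < \<delta>" and \<rho>: "0 < \<rho>" "8 * \<rho> \<le> A" "5 * \<rho> \<le> \<delta>"
  shows "hausdorff_content h \<delta> E \<le> packing_content h \<rho> E"
proof (rule ennreal_le_epsilon)
  note h = dim_funsD[OF D]
  fix e :: real assume fin: "packing_content h \<rho> E < top" and e: "0 < e"
  obtain c where c: "c > 0" "\<And>x. 0 < x \<Longrightarrow> 2 * x \<le> A \<Longrightarrow> h (2 * x) \<le> c * h x"
    using doublingE[OF D] by metis
  \<comment> \<open>Three doublings lead from 2r to 16r, which exceeds 10r. The hypothesis on
    8\<rho> keeps 16r inside the domain.\<close>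
  have c10: "h (10 * r) \<le> c ^ 3 * h (2 * r)" if "0 < r" "2 * r \<le> \<rho>" for r
  proof -
    have "h (10 * r) \<le> h (2 * (2 * (2 * (2 * r))))" using that \<rho> by (intro h(4)) auto
    also have "\<dots> \<le> c * h (2 * (2 * (2 * r)))" using that \<rho> by (intro c) auto
    also have "\<dots> \<le> c * (c * h (2 * (2 * r)))" using that \<rho> c(1) by (intro mult_left_mono c) auto
    also have "\<dots> \<le> c * (c * (c * h (2 * r)))" using that \<rho> c(1) by (intro mult_left_mono c) auto
    finally show ?thesis by (simp add: power3_eq_cube mult_ac)
  qed
  \<comment> \<open>All admissible pairs of centre and radius; the strict bound on the radius keeps
    the diameters below \<rho>, as a packing requires.\<close>
  define K where "K = E \<times> {0<..<\<rho>/2}"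
  obtain C where C: "countable C" "C \<subseteq> K"
     "pairwise (\<lambda>i j. disjnt (cball (fst i) (snd i)) (cball (fst j) (snd j))) C"
     "\<And>i. i \<in> K \<Longrightarrow> \<exists>j. j \<in> C \<and> \<not> disjnt (cball (fst i) (snd i)) (cball (fst j) (snd j)) \<and>
                        cball (fst i) (snd i) \<subseteq> ball (fst j) (5 * snd j)"
  proof (rule Vitali_covering_lemma_cballs_balls[of K snd "\<rho>/2" fst])
    show "0 < snd i \<and> snd i \<le> \<rho> / 2" if "i \<in> K" for i using that by (auto simp: K_def)
  qed blast
  have Cpos: "0 < snd i" "2 * snd i \<le> \<rho>" "2 * snd i < \<rho>" "fst i \<in> E" if "i \<in> C" for i
    using that C(2) by (auto simp: K_def)
  define \<beta> where "\<beta> i = ball (fst i) (snd i)" for i :: "real \<times> real"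
  have diam\<beta>: "diameter (\<beta> i) = 2 * snd i" if "i \<in> C" for i using Cpos[OF that] by (simp add: \<beta>_def)
  have disj: "\<beta> i \<inter> \<beta> j = {}" if "i \<in> C" "j \<in> C" "i \<noteq> j" for i j
    using C(3) that ball_subset_cball[of "fst i" "snd i"] ball_subset_cball[of "fst j" "snd j"]
    unfolding \<beta>_def pairwise_def disjnt_def by blast
  have inj: "inj_on \<beta> C"
  proof (rule inj_onI, rule ccontr)
    fix i j assume ij: "i \<in> C" "j \<in> C" "\<beta> i = \<beta> j" "i \<noteq> j"
    then have "\<beta> i = {}" using disj by blast
    then show False using Cpos[OF ij(1)] by (simp add: \<beta>_def)
  qed
  have "\<beta> ` C \<in> packings \<rho> E"
    unfolding packings_def
  proof (intro CollectI conjI ballI)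
    show "disjoint (\<beta> ` C)" unfolding disjoint_def using disj by blast
    fix B assume "B \<in> \<beta> ` C"
    then obtain i where i: "i \<in> C" "B = \<beta> i" by auto
    then show "\<exists>x\<in>E. \<exists>r>0. B = ball x r \<and> diameter B < \<rho>"
      using Cpos[OF i(1)] diam\<beta>[OF i(1)] by (intro bexI[of _ "fst i"] exI[of _ "snd i"]) (auto simp: \<beta>_def)
  qed
  then have "(\<Sum>\<^sub>\<infinity>B\<in>\<beta> ` C. ennreal (h (diameter B))) \<le> packing_content h \<rho> E"
    unfolding packing_content_def by (rule SUP_upper)
  also have "(\<Sum>\<^sub>\<infinity>B\<in>\<beta> ` C. ennreal (h (diameter B))) = (\<Sum>\<^sub>\<infinity>i\<in>C. ennreal (h (2 * snd i)))"
    unfolding infsum_reindex[OF inj] by (rule infsum_cong) (simp add: diam\<beta>)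
  finally have S: "(\<Sum>\<^sub>\<infinity>i\<in>C. ennreal (h (2 * snd i))) \<le> packing_content h \<rho> E" .
  define S where "S = (\<Sum>\<^sub>\<infinity>i\<in>C. ennreal (h (2 * snd i)))"
  have Sfin: "S < top" using S fin unfolding S_def by (rule le_less_trans)
  \<comment> \<open>Enlarging the tail multiplies its cost by at most \<open>c ^ 3\<close>, so a
    tail below \<open>e'\<close> costs at most \<open>e\<close> afterwards.\<close>
  define e' where "e' = e / c ^ 3"
  have e': "e' > 0" using e c by (simp add: e'_def)
  obtain F where F: "finite F" "F \<subseteq> C" "S \<le> (\<Sum>i\<in>F. ennreal (h (2 * snd i))) + ennreal e'"
  proof -
    have "S = (SUP F\<in>{F. finite F \<and> F \<subseteq> C}. (\<Sum>i\<in>F. ennreal (h (2 * snd i))))"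
      unfolding S_def by (rule nonneg_infsum_complete) auto
    from SUP_approx_ennreal[OF e' _ this] Sfin
    obtain F where "finite F" "F \<subseteq> C" "S < (\<Sum>i\<in>F. ennreal (h (2 * snd i))) + ennreal e'" by auto
    then show ?thesis by (intro that) auto
  qed
  have split: "S = (\<Sum>i\<in>F. ennreal (h (2 * snd i))) + (\<Sum>\<^sub>\<infinity>i\<in>C - F. ennreal (h (2 * snd i)))"
    unfolding S_def by (rule infsum_ennreal_split_finite[OF F(1,2)])
  have Ffin: "(\<Sum>i\<in>F. ennreal (h (2 * snd i))) < top"
    using Sfin split by auto
  then have tail: "(\<Sum>\<^sub>\<infinity>i\<in>C - F. ennreal (h (2 * snd i))) \<le> ennreal e'"
    using F(3) Ffin unfolding split by (auto simp: ennreal_add_left_cancel_le)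
  \<comment> \<open>Closed balls make the union over \<open>F\<close> closed, so a point outside has
    a neighbourhood missing it. Passing to the closed ball leaves the diameter, hence the cost,
    unchanged.\<close>
  define V where "V i = (if i \<in> F then cball (fst i) (snd i) else ball (fst i) (5 * snd i))" for i :: "real \<times> real"
  have diamV: "diameter (V i) = (if i \<in> F then 2 * snd i else 10 * snd i)" if "i \<in> C" for i
    using Cpos[OF that] by (simp add: V_def)
  have cover: "E \<subseteq> (\<Union>i\<in>C. V i)"
  proof
    fix x assume x: "x \<in> E"
    show "x \<in> (\<Union>i\<in>C. V i)"
    proof (cases "x \<in> (\<Union>i\<in>F. cball (fst i) (snd i))")
      case True
      then show ?thesis using F(2) by (auto simp: V_def)
    next
      case False
      have "closed (\<Union>i\<in>F. cball (fst i) (snd i))" using F(1) by auto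
      then have "open (- (\<Union>i\<in>F. cball (fst i) (snd i)))" by (rule open_Compl)
      then obtain r where r: "r > 0" "cball x r \<subseteq> - (\<Union>i\<in>F. cball (fst i) (snd i))"
        using False unfolding open_contains_cball by blast
      \<comment> \<open>A small ball around \<open>x\<close> is itself a candidate. The selected
        ball that it meets cannot come from \<open>F\<close>, so it is one of the enlarged
        ones.\<close>
      define q where "q = min r (\<rho> / 4)"
      have q: "0 < q" "q \<le> r" "q < \<rho> / 2" using r \<rho> by (auto simp: q_def)
      then have "(x, q) \<in> K" using x by (auto simp: K_def)
      then obtain j where j: "j \<in> C" "\<not> disjnt (cball x q) (cball (fst j) (snd j))"
         "cball x q \<subseteq> ball (fst j) (5 * snd j)" using C(4) by fastforce
      have "j \<notin> F"
      proof
        assume "j \<in> F"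
        then have "cball x r \<inter> cball (fst j) (snd j) = {}" using r(2) by blast
        moreover have "cball x q \<subseteq> cball x r" using q(2) by (simp add: subset_cball)
        ultimately show False using j(2) unfolding disjnt_def by blast
      qed
      moreover have "x \<in> ball (fst j) (5 * snd j)"
        using j(3) q(1) by (meson centre_in_cball less_imp_le subsetD)
      ultimately show ?thesis using j(1) by (force simp: V_def)
    qed
  qed
  have "hausdorff_content h \<delta> E \<le> (\<Sum>\<^sub>\<infinity>i\<in>C. ennreal (h (diameter (V i))))"
  proof (rule hausdorff_content_le_infsum[where V = V, OF C(1) _ less_imp_le[OF \<delta>] cover])
    show "h 0 = 0" by (rule h(2))
    fix i assume i: "i \<in> C"
    show "bounded (V i) \<and> diameter (V i) \<le> \<delta>"
      using Cpos[OF i] \<rho> diamV[OF i] by (auto simp: V_def)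
  qed
  also have "\<dots> = (\<Sum>i\<in>F. ennreal (h (diameter (V i)))) + (\<Sum>\<^sub>\<infinity>i\<in>C - F. ennreal (h (diameter (V i))))"
    by (rule infsum_ennreal_split_finite[OF F(1,2)])
  also have "\<dots> \<le> (\<Sum>i\<in>F. ennreal (h (2 * snd i))) + ennreal e"
  proof (rule add_mono)
    show "(\<Sum>i\<in>F. ennreal (h (diameter (V i)))) \<le> (\<Sum>i\<in>F. ennreal (h (2 * snd i)))"
      using F(2) diamV by (intro sum_mono) auto
    have "(\<Sum>\<^sub>\<infinity>i\<in>C - F. ennreal (h (diameter (V i)))) \<le> (\<Sum>\<^sub>\<infinity>i\<in>C - F. ennreal (c ^ 3) * ennreal (h (2 * snd i)))"
    proof (rule infsum_mono)
      fix i assume i: "i \<in> C - F"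
      then have "h (10 * snd i) \<le> c ^ 3 * h (2 * snd i)" using Cpos[of i] by (intro c10) auto
      moreover have "0 \<le> h (2 * snd i)" using Cpos[of i] i h(3)[of "2 * snd i"] \<rho> by force
      ultimately show "ennreal (h (diameter (V i))) \<le> ennreal (c ^ 3) * ennreal (h (2 * snd i))"
        using i c(1) diamV[of i] by (simp flip: ennreal_mult)
    qed (auto intro: nonneg_summable_on_complete)
    also have "\<dots> = ennreal (c ^ 3) * (\<Sum>\<^sub>\<infinity>i\<in>C - F. ennreal (h (2 * snd i)))"
      by (rule infsum_ennreal_cmult)
    also have "\<dots> \<le> ennreal (c ^ 3) * ennreal e'"
      by (intro mult_left_mono tail) auto
    also have "\<dots> = ennreal e" using c(1) e by (simp add: e'_def flip: ennreal_mult)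
    finally show "(\<Sum>\<^sub>\<infinity>i\<in>C - F. ennreal (h (diameter (V i)))) \<le> ennreal e" .
  qed
  also have "\<dots> \<le> packing_content h \<rho> E + ennreal e"
  proof (rule add_right_mono)
    have "(\<Sum>i\<in>F. ennreal (h (2 * snd i))) \<le> S" unfolding split by simp
    then show "(\<Sum>i\<in>F. ennreal (h (2 * snd i))) \<le> packing_content h \<rho> E" using S unfolding S_def by simp
  qed
  finally show "hausdorff_content h \<delta> E \<le> packing_content h \<rho> E + ennreal e" .
qed

lemma hausdorff_meas_le_packing_premeas:
  assumes D: "(A, h) \<in> dim_funs"
  shows "hausdorff_meas h E \<le> packing_premeas h E"
  unfolding hausdorff_meas_eq_SUP packing_premeas_eq_INF
proof (intro SUP_least INF_greatest)
  fix \<delta> \<epsilon> :: real assume "\<delta> \<in> {0<..}" "\<epsilon> \<in> {0<..}"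
  then have pos: "0 < \<delta>" "0 < \<epsilon>" "0 < A" using dim_funsD(1)[OF D] by auto
  define \<rho> where "\<rho> = min \<epsilon> (min (\<delta> / 5) (A / 8))"
  have "hausdorff_content h \<delta> E \<le> packing_content h \<rho> E"
    by (rule hausdorff_content_le_packing_content[OF D]) (use pos in \<open>auto simp: \<rho>_def min_def\<close>)
  also have "\<dots> \<le> packing_content h \<epsilon> E" by (rule packing_content_mono) (simp add: \<rho>_def)
  finally show "hausdorff_content h \<delta> E \<le> packing_content h \<epsilon> E" .
qed

text \<open>The comparison with the premeasure is applied to each piece of a decomposition;
  countable subadditivity of the Hausdorff measure then adds the pieces up.\<close>

lemma hausdorff_meas_le_packing_meas:
  assumes D: "(A, h) \<in> dim_funs"
  shows "hausdorff_meas h E \<le> packing_meas h E"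
  unfolding packing_meas_def
proof (rule Inf_greatest)
  fix s assume "s \<in> {(\<Sum>i. packing_premeas h (F i)) | F :: nat \<Rightarrow> real set. E = (\<Union>i. F i)}"
  then obtain F :: "nat \<Rightarrow> real set" where F: "s = (\<Sum>i. packing_premeas h (F i))" "E = (\<Union>i. F i)" by auto
  have "hausdorff_meas h E \<le> (\<Sum>i. hausdorff_meas h (F i))"
    unfolding F(2) by (rule hausdorff_meas_Union) (rule dim_funsD(2)[OF D])
  also have "\<dots> \<le> s"
    unfolding F(1) by (intro suminf_le hausdorff_meas_le_packing_premeas[OF D]) auto
  finally show "hausdorff_meas h E \<le> s" .
qed

lemma packing_premeas_empty: "packing_premeas h {} = 0"
proof -
  have "packings \<delta> {} = {{}}" for \<delta> by (auto simp: packings_def)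
  then have "packing_content h \<delta> {} = 0" for \<delta> by (simp add: packing_content_def)
  then show ?thesis by (simp add: packing_premeas_eq_INF)
qed

lemma packing_meas_le_premeas: "packing_meas h E \<le> packing_premeas h E"
proof -
  define F :: "nat \<Rightarrow> real set" where "F i = (if i = 0 then E else {})" for i
  have "(\<Sum>i. packing_premeas h (F i)) = (\<Sum>i\<in>{0}. packing_premeas h (F i))"
    by (rule suminf_finite) (auto simp: F_def packing_premeas_empty)
  then have "(\<Sum>i. packing_premeas h (F i)) = packing_premeas h E" by (simp add: F_def)
  moreover have "E = (\<Union>i. F i)" by (auto simp: F_def split: if_splits)
  ultimately show ?thesis unfolding packing_meas_def by (intro Inf_lower) (metis (mono_tags, lifting) mem_Collect_eq)
qed

text \<open>Used to thicken a covering set into an open one at arbitrarily small extra cost. A set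
  of diameter 0 is included, through the limit of \<open>h\<close> at 0.\<close>

lemma right_continuous_gauge:
  assumes D: "(A, h) \<in> dim_funs" and d: "0 \<le> d" "d < B" "B \<le> A" and e: "0 < e"
  obtains d' where "d < d'" "d' \<le> B" "h d' \<le> h d + e"
proof -
  note h = dim_funsD[OF D]
  have "(h \<longlongrightarrow> h d) (at_right d)"
  proof (cases "d = 0")
    case True
    then show ?thesis using h(2,6) by simp
  next
    case False
    have "continuous_on {d..A} h" by (rule continuous_on_subset[OF h(5)]) (use d False in auto)
    then show ?thesis using d by (intro continuous_on_Icc_at_rightD[of d A]) auto
  qed
  then have "\<forall>\<^sub>F x in at_right d. h x < h d + e" using e by (intro order_tendstoD) auto
  moreover have "\<forall>\<^sub>F x in at_right d. x < B" using d by (intro order_tendstoD(2)[OF tendsto_ident_at])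
  moreover have "\<forall>\<^sub>F x in at_right d. d < x" by (rule eventually_at_right_less)
  ultimately have "\<forall>\<^sub>F x in at_right d. d < x \<and> x \<le> B \<and> h x \<le> h d + e" by eventually_elim auto
  from eventually_happens'[OF _ this] show ?thesis using that by auto
qed

section \<open>Tails and interval lengths\<close>

locale cantor_sequence =
  fixes a :: "nat \<Rightarrow> real"
  assumes a_pos: "1 \<le> n \<Longrightarrow> 0 < a n"
    and a_antimono: "1 \<le> m \<Longrightarrow> m \<le> n \<Longrightarrow> a n \<le> a m"
    and a_summable: "summable a"
begin

abbreviation level :: "nat \<Rightarrow> nat set" where
  "level k \<equiv> {2 ^ k..<2 ^ (k + 1)}"

text \<open>The dyadic sample n = 2^k of the points r_n/n in the definition of
  \<open>associated\<close>; it turns out to be the average length of the intervals of level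
  \<open>k\<close>.\<close>

definition scale :: "nat \<Rightarrow> real" where
  "scale k = seq_tail a (2 ^ k) / 2 ^ k"

lemma summable_shift: "summable (\<lambda>j. a (n + j))"
  using summable_ignore_initial_segment[OF a_summable, of n] by (simp add: add.commute)

lemma seq_tail_Suc: "seq_tail a n = a n + seq_tail a (Suc n)"
proof -
  have "(\<Sum>j. a (n + Suc j)) = (\<Sum>j. a (n + j)) - a (n + 0)"
    by (rule suminf_split_head[OF summable_shift])
  moreover have "(\<lambda>j. a (n + Suc j)) = (\<lambda>j. a (Suc n + j))" by simp
  ultimately show ?thesis unfolding seq_tail_def by simp
qed

lemma seq_tail_split: "m \<le> n \<Longrightarrow> seq_tail a m = sum a {m..<n} + seq_tail a n"
proof (induction n rule: dec_induct)
  case (step n)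
  then show ?case unfolding seq_tail_Suc[of n] by simp
qed simp

lemma seq_tail_pos: "1 \<le> n \<Longrightarrow> 0 < seq_tail a n"
  unfolding seq_tail_def
proof (rule suminf_pos[OF summable_shift])
  show "0 < a (n + j)" if "1 \<le> n" for j using that by (intro a_pos) linarith
qed

lemma seq_tail_antimono: "1 \<le> m \<Longrightarrow> m \<le> n \<Longrightarrow> seq_tail a n \<le> seq_tail a m"
proof -
  assume mn: "1 \<le> m" "m \<le> n"
  have "0 \<le> sum a {m..<n}" using mn by (intro sum_nonneg less_imp_le[OF a_pos]) auto
  then show ?thesis using seq_tail_split[OF mn(2)] by linarith
qed

lemma scale_pos: "0 < scale k"
  by (simp add: scale_def seq_tail_pos)

lemma scale_Suc_le: "scale (Suc k) \<le> scale k / 2"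
  using seq_tail_antimono[of "2 ^ k" "2 ^ Suc k"] by (simp add: scale_def field_simps)

lemma scale_decseq: "decseq scale"
  unfolding decseq_Suc_iff
proof
  show "scale (Suc n) \<le> scale n" for n using scale_Suc_le[of n] scale_pos[of n] by linarith
qed

lemma scale_antimono: "i \<le> j \<Longrightarrow> scale j \<le> scale i"
  using scale_decseq by (simp add: decseq_def)

lemma scale_tendsto_0: "scale \<longlonglongrightarrow> 0"
proof (rule tendsto_sandwich[where f = "\<lambda>_. 0" and h = "\<lambda>k. seq_tail a 1 * (1 / 2) ^ k"])
  show "(\<lambda>k. seq_tail a 1 * (1 / 2) ^ k) \<longlonglongrightarrow> 0"
    by (intro tendsto_mult_right_zero LIMSEQ_power_zero) auto
  show "\<forall>\<^sub>F k in sequentially. scale k \<le> seq_tail a 1 * (1 / 2) ^ k"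
    using seq_tail_antimono[of 1 "2 ^ k" for k]
    by (intro always_eventually) (simp add: scale_def field_simps)
  show "\<forall>\<^sub>F k in sequentially. 0 \<le> scale k"
    using less_imp_le[OF scale_pos] by (intro always_eventually) blast
qed auto

lemma scale_lessE:
  assumes "0 < e"
  obtains k where "m \<le> k" "scale k < e"
proof -
  have "\<forall>\<^sub>F k in sequentially. scale k < e \<and> m \<le> k"
    using order_tendstoD(2)[OF scale_tendsto_0 assms] eventually_ge_at_top[of m]
    by eventually_elim auto
  from eventually_happens'[OF sequentially_bot this] show ?thesis using that by blast
qed

text \<open>The scales decrease to 0, so the intervals from \<open>scale (Suc k)\<close> to
  \<open>scale k\<close> exhaust all small positive sizes. This assigns a level to each
  size.\<close>

lemma scale_bracketE:
  assumes "0 < x" "x \<le> scale m"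
  obtains k where "m \<le> k" "scale (Suc k) < x" "x \<le> scale k"
proof -
  define k where "k = (LEAST k. m \<le> k \<and> scale (Suc k) < x)"
  obtain j where "m \<le> j" "scale j < x" using scale_lessE[OF assms(1)] .
  then have "m \<le> j \<and> scale (Suc j) < x" using scale_antimono[of j "Suc j"] by auto
  then have k: "m \<le> k \<and> scale (Suc k) < x" unfolding k_def by (rule LeastI)
  have "x \<le> scale k"
  proof (cases "k = m")
    case True
    then show ?thesis using assms by simp
  next
    case False
    then have "k - 1 < k" "m \<le> k - 1" "Suc (k - 1) = k" using k by auto
    then show ?thesis using not_less_Least[of "k - 1" "\<lambda>k. m \<le> k \<and> scale (Suc k) < x"]
      unfolding k_def[symmetric] by auto
  qed
  then show ?thesis using that k by blast
qed

section \<open>Interval lengths and their sums over a level\<close>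

lemma sum_children: "m \<le> n \<Longrightarrow> (\<Sum>i=m..<n. f (2 * i) + f (2 * i + 1)) = sum f {2 * m..<2 * n}"
  for f :: "nat \<Rightarrow> real"
proof (induction n rule: dec_induct)
  case (step n)
  have eq: "2 * Suc n = Suc (Suc (2 * n))" by simp
  have le: "2 * m \<le> 2 * n" "2 * m \<le> Suc (2 * n)" using step.hyps by linarith+
  have "sum f {2 * m..<2 * Suc n} = sum f {2 * m..<2 * n} + (f (2 * n) + f (2 * n + 1))"
    unfolding eq sum.atLeastLessThan_Suc[OF le(2)] sum.atLeastLessThan_Suc[OF le(1)] by simp
  then show ?case
    unfolding sum.atLeastLessThan_Suc[OF step.hyps(1)] step.IH by simp
qed simp

lemma sum_level_mono: "(\<Sum>j<2 ^ k. a (2 ^ k * n + j)) \<le> (\<Sum>j<2 ^ k. a (2 ^ k * m + j))" if "1 \<le> m" "m \<le> n"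
proof (intro sum_mono a_antimono)
  fix j :: nat
  have "1 \<le> 2 ^ k * m" using that by simp
  then show "1 \<le> 2 ^ k * m + j" by linarith
  show "2 ^ k * m + j \<le> 2 ^ k * n + j" using that by simp
qed

text \<open>The blocks from 2^k to 2^(k+1) - 1 tile the positive integers. The series also majorizes
  those of all other interval lengths.\<close>

lemma level_sums: "(\<lambda>k. \<Sum>j<2 ^ k. a (2 ^ k * 1 + j)) sums seq_tail a 1"
proof -
  have *: "(\<Sum>k<K. \<Sum>j<2 ^ k. a (2 ^ k * 1 + j)) = sum a {1..<2 ^ K}" for K
  proof (induction K)
    case (Suc K)
    have "sum a {2 ^ K..<2 ^ Suc K} = sum a {0 + 2 ^ K..<2 ^ K + 2 ^ K}"
      by (simp only: power_Suc mult_2 add_0)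
    also have "\<dots> = (\<Sum>j=0..<2 ^ K. a (j + 2 ^ K))" by (rule sum.shift_bounds_nat_ivl)
    also have "\<dots> = (\<Sum>j<2 ^ K. a (2 ^ K * 1 + j))"
      by (intro sum.cong) (auto simp: add.commute[of _ "2 ^ K"])
    finally show ?case using Suc sum.atLeastLessThan_concat[of 1 "2 ^ K" "2 ^ Suc K" a] by simp
  qed simp
  have "(\<lambda>n. sum a {1..<Suc n}) = (\<lambda>n. \<Sum>j<n. a (1 + j))"
    using sum.shift_bounds_Suc_ivl[of a 0] by (simp add: atLeast0LessThan)
  then have "(\<lambda>n. sum a {1..<Suc n}) \<longlonglongrightarrow> seq_tail a 1"
    using summable_LIMSEQ[OF summable_shift[of 1]] by (simp add: seq_tail_def)
  then have "(\<lambda>n. sum a {1..<n}) \<longlonglongrightarrow> seq_tail a 1"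
    by (subst (asm) filterlim_sequentially_Suc)
  moreover have "filterlim (\<lambda>K. 2 ^ K :: nat) at_top sequentially"
    by (rule filterlim_at_top_mono[OF filterlim_ident]) (auto intro!: always_eventually less_imp_le)
  ultimately show ?thesis
    unfolding sums_def * by (rule filterlim_compose)
qed

lemma level_summable: "summable (\<lambda>k. \<Sum>j<2 ^ k. a (2 ^ k * n + j))" if "1 \<le> n"
proof (rule summable_comparison_test'[OF sums_summable[OF level_sums]])
  fix k :: nat
  have "0 \<le> (\<Sum>j<2 ^ k. a (2 ^ k * n + j))"
    using that by (intro sum_nonneg less_imp_le[OF a_pos]) (simp add: trans_le_add1)
  then show "norm (\<Sum>j<2 ^ k. a (2 ^ k * n + j)) \<le> (\<Sum>j<2 ^ k. a (2 ^ k * 1 + j))"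
    using sum_level_mono[of 1 n k] that by simp
qed

lemma length_antimono: "1 \<le> m \<Longrightarrow> m \<le> n \<Longrightarrow> cantor_length a n \<le> cantor_length a m"
  unfolding cantor_length_def by (intro suminf_le level_summable sum_level_mono) auto

lemma length_rec: "1 \<le> n \<Longrightarrow> cantor_length a n = a n + cantor_length a (2 * n) + cantor_length a (2 * n + 1)"
  using cantor_length_rec[OF a_pos a_summable] by blast

lemma length_pos: "1 \<le> n \<Longrightarrow> 0 < cantor_length a n"
  unfolding cantor_length_def by (intro suminf_pos level_summable sum_pos a_pos) (auto simp: trans_le_add1 lessThan_empty_iff)

lemma level_ge_1: "n \<in> level k \<Longrightarrow> 1 \<le> n"
  by (meson atLeastLessThan_iff le_trans one_le_numeral one_le_power)

text \<open>Passing to the next level removes precisely the gaps \<open>a n\<close> with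
  \<open>n\<close> in the current level, and the tail drops by the same amount.\<close>

lemma sum_length_level: "sum (cantor_length a) (level k) = seq_tail a (2 ^ k)"
proof (induction k)
  case 0
  have "cantor_length a 1 = seq_tail a 1"
    unfolding cantor_length_def by (rule sums_unique[OF level_sums, symmetric])
  then show ?case by (simp add: numeral_2_eq_2)
next
  case (Suc k)
  have "sum (cantor_length a) (level k) = (\<Sum>n\<in>level k. a n + (cantor_length a (2 * n) + cantor_length a (2 * n + 1)))"
    by (intro sum.cong refl) (subst length_rec, erule level_ge_1, simp)
  also have "\<dots> = sum a (level k) + sum (cantor_length a) (level (Suc k))"
    unfolding sum.distrib[of a] using sum_children[of "2 ^ k" "2 ^ (k + 1)" "cantor_length a"] by simp
  finally show ?case using Suc seq_tail_split[of "2 ^ k" "2 ^ (k + 1)"] by simp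
qed

text \<open>Lengths are non-increasing in the index, so the interval \<open>n\<close> is at least as
  long as every interval of the next level, hence as their average.\<close>

lemma scale_le_length:
  assumes "n \<in> level k"
  shows "scale (Suc k) \<le> cantor_length a n"
proof -
  have "seq_tail a (2 ^ Suc k) \<le> of_nat (card (level (Suc k))) * cantor_length a n"
    unfolding sum_length_level[symmetric] using assms level_ge_1[OF assms]
    by (intro sum_bounded_above length_antimono) auto
  then show ?thesis by (simp add: scale_def field_simps)
qed

text \<open>By the same monotonicity, the length is at most the average over the previous
  level.\<close>

lemma length_le_scale:
  assumes "n \<in> level (Suc k)"
  shows "cantor_length a n \<le> scale k"
proof -
  have "of_nat (card (level k)) * cantor_length a n \<le> seq_tail a (2 ^ k)"
    unfolding sum_length_level[symmetric] using assms
    by (intro sum_bounded_below length_antimono) (auto dest: level_ge_1)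
  then show ?thesis by (simp add: scale_def field_simps)
qed

section \<open>Gauges associated to the sequence\<close>

text \<open>Association tested only along n = 2^k and from some level on. Every later argument works
  level by level and uses this form.\<close>

definition dyadic_gauge :: "gauge \<Rightarrow> bool" where
  "dyadic_gauge = (\<lambda>(A, h). \<exists>P c1 c2. 0 < c1 \<and> 0 < c2 \<and> scale P \<le> A \<and>
     (\<forall>k\<ge>P. c1 / 2 ^ k \<le> h (scale k) \<and> h (scale k) \<le> c2 / 2 ^ k))"

lemma dyadic_gaugeE:
  assumes "dyadic_gauge (A, h)"
  obtains P c1 c2 where "0 < c1" "0 < c2" "scale P \<le> A"
    "\<And>k. P \<le> k \<Longrightarrow> c1 / 2 ^ k \<le> h (scale k)" "\<And>k. P \<le> k \<Longrightarrow> h (scale k) \<le> c2 / 2 ^ k"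
  using assms unfolding dyadic_gauge_def by auto

text \<open>Two thresholds are allowed because the lower and the upper bound are obtained by
  separate arguments.\<close>

lemma dyadic_gaugeI:
  assumes "0 < c1" "0 < c2" "scale P \<le> A" "scale Q \<le> A"
    "\<And>k. P \<le> k \<Longrightarrow> c1 / 2 ^ k \<le> h (scale k)" "\<And>k. Q \<le> k \<Longrightarrow> h (scale k) \<le> c2 / 2 ^ k"
  shows "dyadic_gauge (A, h)"
  unfolding dyadic_gauge_def prod.case
  by (rule exI[of _ "max P Q"], rule exI[of _ c1], rule exI[of _ c2]) (use assms in \<open>auto simp: max_def\<close>)

text \<open>Between consecutive powers of 2 monotonicity of \<open>h\<close> and of r_n/n costs a
  factor 2 at most, and the finitely many n below 2^P only affect the constants.\<close>

lemma associated_iff_dyadic: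
  assumes D: "(A, h) \<in> dim_funs"
  shows "associated (A, h) a \<longleftrightarrow> dyadic_gauge (A, h)"
proof
  note h = dim_funsD[OF D]
  assume "associated (A, h) a"
  then obtain c1 c2 where c: "0 < c1" "0 < c2"
    "\<And>n. 1 \<le> n \<Longrightarrow> seq_tail a n / real n \<le> A \<Longrightarrow>
      c1 \<le> h (seq_tail a n / real n) / (1 / real n) \<and> h (seq_tail a n / real n) / (1 / real n) \<le> c2"
    unfolding associated_def seq_equiv_on_def by auto
  obtain P where P: "scale P < A" using scale_lessE[OF h(1)] .
  have main: "c1 / 2 ^ k \<le> h (scale k) \<and> h (scale k) \<le> c2 / 2 ^ k" if "P \<le> k" for k
  proof -
    have "seq_tail a (2 ^ k) / real (2 ^ k) = scale k" by (simp add: scale_def)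
    moreover have "scale k \<le> A" using scale_antimono[OF that] P by simp
    ultimately show ?thesis using c(3)[of "2 ^ k"] by (simp add: field_simps)
  qed
  show "dyadic_gauge (A, h)"
    by (rule dyadic_gaugeI[OF c(1,2) less_imp_le[OF P] less_imp_le[OF P]]) (use main in blast)+
next
  note h = dim_funsD[OF D]
  assume "dyadic_gauge (A, h)"
  then obtain P c1 c2 where c: "0 < c1" "0 < c2" "scale P \<le> A"
    "\<And>k. P \<le> k \<Longrightarrow> c1 / 2 ^ k \<le> h (scale k)" "\<And>k. P \<le> k \<Longrightarrow> h (scale k) \<le> c2 / 2 ^ k"
    by (elim dyadic_gaugeE) blast
  define b where "b n = seq_tail a n / real n" for n
  have b_pos: "0 < b n" if "1 \<le> n" for n using seq_tail_pos[OF that] that by (simp add: b_def)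
  have b_antimono: "b n \<le> b m" if "1 \<le> m" "m \<le> n" for m n
    using seq_tail_antimono[OF that] seq_tail_pos[of n] that by (auto simp: b_def intro!: frac_le)
  have b_scale: "b (2 ^ k) = scale k" for k by (simp add: b_def scale_def)
  \<comment> \<open>The first entries of the minimum and the maximum serve n at least 2^P; the
    second ones serve smaller n, where \<open>h (b n)\<close> lies between
    \<open>h (scale P)\<close> and \<open>h A\<close>.\<close>
  define C1 where "C1 = min (c1 / 2) (h (scale P))"
  define C2 where "C2 = max (2 * c2) (2 ^ P * h A)"
  have "0 < C1" "0 < C2" using c h(3)[OF scale_pos c(3)] by (auto simp: C1_def C2_def)
  moreover have "C1 \<le> h (b n) / (1 / real n) \<and> h (b n) / (1 / real n) \<le> C2" if n: "1 \<le> n" "b n \<le> A" for n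
  proof (cases "2 ^ P \<le> n")
    case True
    obtain k where k: "2 ^ k \<le> n" "n < 2 ^ (k + 1)" using ex_power_ivl1[of 2 n] n(1) by auto
    have "(2::nat) ^ P < 2 ^ (k + 1)" using True k(2) by linarith
    then have "P < k + 1" by (rule power_less_imp_less_exp[rotated]) simp
    then have Pk: "P \<le> k" by simp
    have sA: "scale k \<le> A" using scale_antimono[OF Pk] c(3) by simp
    have nr: "2 ^ k \<le> real n" "real n \<le> 2 * 2 ^ k"
    proof -
      have "real (2 ^ k) \<le> real n" "real n \<le> real (2 ^ (k + 1))" using k by (intro of_nat_mono; simp)+
      then show "2 ^ k \<le> real n" "real n \<le> 2 * 2 ^ k" by simp_all
    qed
    have "h (b n) \<le> h (scale k)"
      unfolding b_scale[symmetric] using k n b_pos[OF n(1)] b_antimono[of "2 ^ k" n] sA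
      by (intro h(4)) (auto simp: b_scale)
    then have "h (b n) \<le> c2 / 2 ^ k" using c(5)[OF Pk] by simp
    then have "real n * h (b n) \<le> 2 * 2 ^ k * (c2 / 2 ^ k)"
      using nr c(2) h(3)[OF b_pos[OF n(1)] n(2)] by (intro mult_mono) auto
    moreover have "scale (k + 1) \<le> b n"
      unfolding b_scale[symmetric] by (rule b_antimono[OF n(1) less_imp_le[OF k(2)]])
    then have "h (scale (k + 1)) \<le> h (b n)" by (intro h(4) less_imp_le[OF scale_pos] n(2))
    then have "c1 / 2 ^ (k + 1) \<le> h (b n)" using c(4)[of "k + 1"] Pk by simp
    then have "2 ^ k * (c1 / 2 ^ (k + 1)) \<le> real n * h (b n)"
      using nr c(1) by (intro mult_mono) auto
    ultimately have "c1 / 2 \<le> real n * h (b n)" "real n * h (b n) \<le> 2 * c2"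
      by (simp_all add: field_simps)
    then show ?thesis by (simp add: C1_def C2_def mult.commute min_le_iff_disj le_max_iff_disj)
  next
    case False
    then have "real n \<le> real (2 ^ P)" by (intro of_nat_mono) simp
    moreover have "h (b n) \<le> h A" using n b_pos[OF n(1)] by (intro h(4)) auto
    ultimately have "real n * h (b n) \<le> 2 ^ P * h A"
      using h(3)[OF b_pos[OF n(1)] n(2)] by (intro mult_mono) auto
    moreover have "h (scale P) \<le> h (b n)"
      using n False b_antimono[of n "2 ^ P"] scale_pos[of P] by (intro h(4)) (auto simp: b_scale)
    then have "1 * h (scale P) \<le> real n * h (b n)"
      using n(1) h(3)[OF scale_pos c(3)] by (intro mult_mono) auto
    ultimately show ?thesis by (simp add: C1_def C2_def mult.commute min_le_iff_disj le_max_iff_disj)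
  qed
  ultimately show "associated (A, h) a"
    using h(8) unfolding associated_def seq_equiv_on_def prod.case b_def by auto
qed

lemma dyadic_gauge_le:
  assumes D: "(A, f) \<in> dim_funs" "(B, g) \<in> dim_funs" and dy: "dyadic_gauge (A, f)" "dyadic_gauge (B, g)"
  shows "gauge_le (A, f) (B, g)"
proof -
  note f = dim_funsD[OF D(1)] and g = dim_funsD[OF D(2)]
  obtain P c where c: "0 < c" "scale P \<le> A" "\<And>k. P \<le> k \<Longrightarrow> f (scale k) \<le> c / 2 ^ k"
    using dyadic_gaugeE[OF dy(1)] by metis
  obtain Q d where d: "0 < d" "scale Q \<le> B" "\<And>k. Q \<le> k \<Longrightarrow> d / 2 ^ k \<le> g (scale k)"
    using dyadic_gaugeE[OF dy(2)] by metis
  define R where "R = max P Q"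
  have R: "P \<le> R" "Q \<le> R" "scale R \<le> A" "scale R \<le> B"
    using c(2) d(2) scale_antimono[of P R] scale_antimono[of Q R] by (auto simp: R_def)
  \<comment> \<open>The first entry serves x up to \<open>scale R\<close>, where bracketing loses
    one level, hence the factor 2. The second serves larger x, where f is at most \<open>f A\<close>
    and g at least \<open>g (scale R)\<close>.\<close>
  define K where "K = max (2 * c / d) (f A / g (scale R))"
  have gR: "0 < g (scale R)" by (rule g(3)[OF scale_pos R(4)])
  have K: "0 < K" "2 * c / d \<le> K" "f A / g (scale R) \<le> K" using c(1) d(1) by (auto simp: K_def less_max_iff_disj)
  have "f x \<le> K * g x" if x: "0 < x" "x \<le> A" "x \<le> B" for x
  proof (cases "x \<le> scale R")
    case True
    then obtain k where k: "R \<le> k" "scale (Suc k) < x" "x \<le> scale k" by (rule scale_bracketE[OF x(1)])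
    have sk: "scale k \<le> A" using scale_antimono[OF k(1)] R by simp
    have gx: "d / 2 ^ Suc k \<le> g x"
    proof -
      have "d / 2 ^ Suc k \<le> g (scale (Suc k))" using R k by (intro d(3)) simp
      also have "\<dots> \<le> g x" using k(2) x scale_pos[of "Suc k"] by (intro g(4)) auto
      finally show ?thesis .
    qed
    have "f x \<le> f (scale k)" using x k sk by (intro f(4)) auto
    also have "\<dots> \<le> c / 2 ^ k" using R k by (intro c(3)) simp
    also have "\<dots> = 2 * c / d * (d / 2 ^ Suc k)" using d(1) by simp
    also have "\<dots> \<le> K * g x" using K gx d(1) by (intro mult_mono) auto
    finally show ?thesis .
  next
    case False
    have "f x \<le> f A" using x by (intro f(4)) auto
    also have "\<dots> = f A / g (scale R) * g (scale R)" using gR by simp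
    also have "\<dots> \<le> K * g x" using K gR x False scale_pos[of R] by (intro mult_mono g(4)) auto
    finally show ?thesis .
  qed
  then show ?thesis using K(1) unfolding gauge_le_def by auto
qed

lemma dyadic_gauge_cong:
  assumes D: "(A, f) \<in> dim_funs" "(B, g) \<in> dim_funs" and dy: "dyadic_gauge (A, f)"
    and le: "gauge_le (A, f) (B, g)" "gauge_le (B, g) (A, f)"
  shows "dyadic_gauge (B, g)"
proof -
  obtain P c1 c2 where c: "0 < c1" "0 < c2" "scale P \<le> A"
    "\<And>k. P \<le> k \<Longrightarrow> c1 / 2 ^ k \<le> f (scale k)" "\<And>k. P \<le> k \<Longrightarrow> f (scale k) \<le> c2 / 2 ^ k"
    using dy by (elim dyadic_gaugeE) blast
  obtain u where u: "0 < u" "\<And>x. 0 < x \<Longrightarrow> x \<le> A \<Longrightarrow> x \<le> B \<Longrightarrow> f x \<le> u * g x"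
    using le(1) unfolding gauge_le_def by auto
  obtain v where v: "0 < v" "\<And>x. 0 < x \<Longrightarrow> x \<le> A \<Longrightarrow> x \<le> B \<Longrightarrow> g x \<le> v * f x"
    using le(2) unfolding gauge_le_def by auto
  obtain Q where Q: "P \<le> Q" "scale Q < B" using scale_lessE[OF dim_funsD(1)[OF D(2)]] .
  have k: "scale k \<le> A" "scale k \<le> B" "P \<le> k" if "Q \<le> k" for k
    using that Q c(3) scale_antimono[of P k] scale_antimono[of Q k] by auto
  show ?thesis
  proof (rule dyadic_gaugeI[of "c1 / u" "v * c2" Q _ Q])
    fix j assume j: "Q \<le> j"
    have "c1 / 2 ^ j \<le> u * g (scale j)" using c(4)[OF k(3)[OF j]] u(2)[OF scale_pos k(1,2)[OF j]] by simp
    then show "c1 / u / 2 ^ j \<le> g (scale j)" using u(1) by (simp add: field_simps)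
    have "v * f (scale j) \<le> v * (c2 / 2 ^ j)" using c(5)[OF k(3)[OF j]] v(1) by (intro mult_left_mono) auto
    then show "g (scale j) \<le> v * c2 / 2 ^ j" using v(2)[OF scale_pos k(1,2)[OF j]] by simp
  qed (use c u v Q in auto)
qed

text \<open>The square keeps the terms with \<open>k < m\<close> of order \<open>2^-m\<close> in total at \<open>scale m\<close>; the first
  power would cost a factor \<open>m\<close>.\<close>

definition gauge_term :: "nat \<Rightarrow> real \<Rightarrow> real" where
  "gauge_term k x = (1 / 2) ^ k * min 1 ((x / scale k)\<^sup>2)"

definition gauge_series :: "real \<Rightarrow> real" where
  "gauge_series x = (\<Sum>k. gauge_term k x)"

lemma gauge_term_nonneg: "0 \<le> gauge_term k x"
  by (simp add: gauge_term_def)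

lemma gauge_term_le: "gauge_term k x \<le> (1 / 2) ^ k"
  by (simp add: gauge_term_def mult_le_cancel_left1)

lemma gauge_term_mono: "0 \<le> x \<Longrightarrow> x \<le> y \<Longrightarrow> gauge_term k x \<le> gauge_term k y"
  unfolding gauge_term_def
  by (intro mult_left_mono min.mono power_mono divide_right_mono divide_nonneg_nonneg less_imp_le[OF scale_pos]) auto

lemma summable_half: "summable (\<lambda>k. (1 / 2 :: real) ^ k)"
  by (rule summable_geometric) simp

lemma gauge_term_summable: "summable (\<lambda>k. gauge_term k x)"
proof (rule summable_comparison_test'[OF summable_half])
  show "norm (gauge_term k x) \<le> (1 / 2) ^ k" for k
    using gauge_term_nonneg[of k x] gauge_term_le[of k x] by simp
qed

lemma continuous_gauge_series: "continuous_on UNIV gauge_series"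
proof -
  have "uniformly_convergent_on UNIV (\<lambda>n x. \<Sum>k<n. gauge_term k x)"
  proof (rule Weierstrass_m_test'[OF _ summable_half])
    show "norm (gauge_term k x) \<le> (1 / 2) ^ k" for k x
      using gauge_term_nonneg[of k x] gauge_term_le[of k x] by simp
  qed
  from uniform_limit_suminf[OF this]
  have "uniform_limit UNIV (\<lambda>n x. \<Sum>k<n. gauge_term k x) gauge_series sequentially"
    unfolding gauge_series_def[abs_def] .
  moreover have "scale k \<noteq> 0" for k using scale_pos[of k] by simp
  then have "continuous_on UNIV (\<lambda>x. \<Sum>k<n. gauge_term k x)" for n
    unfolding gauge_term_def by (intro continuous_intros) auto
  ultimately show ?thesis
    by (intro uniform_limit_theorem[where F = sequentially]) auto
qed

lemma gauge_series_0: "gauge_series 0 = 0"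
  by (simp add: gauge_series_def gauge_term_def)

text \<open>The term with index 0 increases strictly until its cap is reached at
  \<open>scale 0\<close>; the other terms are non-decreasing.\<close>

lemma gauge_series_strict_mono:
  assumes "0 \<le> x" "x < y" "x < scale 0"
  shows "gauge_series x < gauge_series y"
proof -
  have split: "gauge_series z = gauge_term 0 z + (\<Sum>k. gauge_term (Suc k) z)" for z
    unfolding gauge_series_def using suminf_split_head[OF gauge_term_summable[of z]] by simp
  have q: "0 \<le> x / scale 0" "x / scale 0 < 1" "x / scale 0 < y / scale 0"
    using assms scale_pos[of 0] by (auto simp: divide_strict_right_mono)
  have "(x / scale 0)\<^sup>2 < 1" using q power_strict_mono[of "x / scale 0" 1 2] by simp
  moreover have "(x / scale 0)\<^sup>2 < (y / scale 0)\<^sup>2" using q by (intro power_strict_mono) auto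
  ultimately have "gauge_term 0 x < gauge_term 0 y" by (simp add: gauge_term_def)
  moreover have "(\<Sum>k. gauge_term (Suc k) x) \<le> (\<Sum>k. gauge_term (Suc k) y)"
  proof (rule suminf_le)
    show "gauge_term (Suc k) x \<le> gauge_term (Suc k) y" for k using assms by (intro gauge_term_mono) auto
    show "summable (\<lambda>k. gauge_term (Suc k) x)" "summable (\<lambda>k. gauge_term (Suc k) y)"
      using summable_ignore_initial_segment[OF gauge_term_summable, of 1] by simp_all
  qed
  ultimately show ?thesis unfolding split by linarith
qed

lemma gauge_series_doubling: "gauge_series (2 * x) \<le> 4 * gauge_series x"
proof -
  have "gauge_term k (2 * x) \<le> 4 * gauge_term k x" for k
  proof -
    have "min 1 ((2 * x / scale k)\<^sup>2) \<le> 4 * min 1 ((x / scale k)\<^sup>2)"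
      by (simp add: power2_eq_square min_def)
    then have "(1 / 2) ^ k * min 1 ((2 * x / scale k)\<^sup>2) \<le> (1 / 2) ^ k * (4 * min 1 ((x / scale k)\<^sup>2))"
      by (rule mult_left_mono) simp
    then show ?thesis by (simp add: gauge_term_def mult_ac)
  qed
  then have "gauge_series (2 * x) \<le> (\<Sum>k. 4 * gauge_term k x)"
    unfolding gauge_series_def by (intro suminf_le gauge_term_summable summable_mult)
  also have "\<dots> = 4 * gauge_series x"
    unfolding gauge_series_def by (rule suminf_mult[OF gauge_term_summable])
  finally show ?thesis .
qed

lemma scale_add_le: "scale (k + j) \<le> scale k / 2 ^ j"
proof (induction j)
  case (Suc j)
  then show ?case using scale_Suc_le[of "k + j"] by simp
qed simp

lemma gauge_series_scale_ge: "1 / 2 ^ m \<le> gauge_series (scale m)"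
proof -
  have "(\<Sum>k\<in>{m}. gauge_term k (scale m)) \<le> gauge_series (scale m)"
    unfolding gauge_series_def by (intro sum_le_suminf gauge_term_summable) (auto intro: gauge_term_nonneg)
  moreover have "gauge_term m (scale m) = 1 / 2 ^ m"
    using scale_pos[of m] by (simp add: gauge_term_def power_divide)
  ultimately show ?thesis by simp
qed

text \<open>The terms from m on are bounded by their caps and give 2/2^m. For k = m - j the scales
  have shrunk by at least 2^j, so the square contributes 4^(-j), and these terms add up to at most
  1/2^m.\<close>

lemma gauge_series_scale_le: "gauge_series (scale m) \<le> 3 / 2 ^ m"
proof -
  have "gauge_series (scale m) = (\<Sum>k. gauge_term (k + m) (scale m)) + (\<Sum>k<m. gauge_term k (scale m))"
    unfolding gauge_series_def by (rule suminf_split_initial_segment[OF gauge_term_summable])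
  also have "(\<Sum>k. gauge_term (k + m) (scale m)) \<le> (\<Sum>k. (1 / 2) ^ m * (1 / 2) ^ k)"
  proof (rule suminf_le)
    show "summable (\<lambda>k. gauge_term (k + m) (scale m))"
      by (rule summable_ignore_initial_segment[OF gauge_term_summable])
    show "gauge_term (k + m) (scale m) \<le> (1 / 2) ^ m * (1 / 2) ^ k" for k
      using gauge_term_le[of "k + m" "scale m"] by (simp add: power_add mult.commute)
  qed (rule summable_mult[OF summable_half])
  also have "\<dots> = 2 / 2 ^ m"
    unfolding suminf_mult[OF summable_half] by (simp add: suminf_geometric power_divide)
  also have "(\<Sum>k<m. gauge_term k (scale m)) \<le> (\<Sum>k<m. 2 ^ k / 4 ^ m)"
  proof (rule sum_mono)
    fix k assume "k \<in> {..<m}"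
    then obtain j where m: "m = k + j" by (auto dest: less_imp_add_positive)
    have "scale m / scale k \<le> 1 / 2 ^ j"
      using scale_add_le[of k j] scale_pos[of k] unfolding m by (simp add: field_simps)
    then have "(scale m / scale k)\<^sup>2 \<le> (1 / 2 ^ j)\<^sup>2"
      using scale_pos[of m] scale_pos[of k] by (intro power_mono) auto
    also have "\<dots> = 1 / 4 ^ j"
      by (simp add: power_divide power2_eq_square flip: power_mult_distrib)
    finally have "gauge_term k (scale m) \<le> (1 / 2) ^ k * (1 / 4 ^ j)"
      unfolding gauge_term_def by (intro mult_left_mono) auto
    also have "\<dots> = 2 ^ k / 4 ^ m"
    proof -
      have "(4::real) ^ k = 2 ^ k * 2 ^ k" by (simp flip: power_mult_distrib)
      then show ?thesis unfolding m power_add power_divide by simp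
    qed
    finally show "gauge_term k (scale m) \<le> 2 ^ k / 4 ^ m" .
  qed
  also have "\<dots> = (2 ^ m - 1) / 4 ^ m"
    by (simp add: sum_divide_distrib[symmetric] sum_power2 geometric_sum)
  also have "\<dots> \<le> 1 / 2 ^ m"
  proof -
    have "(4::real) ^ m = 2 ^ m * 2 ^ m" by (simp flip: power_mult_distrib)
    then show ?thesis by (simp add: field_simps)
  qed
  finally show ?thesis by simp
qed

text \<open>Beyond \<open>scale 0\<close> all terms have reached their caps and the series is
  constant, so the domain has to end there.\<close>

definition cantor_gauge :: gauge where
  "cantor_gauge = (scale 0, restrict gauge_series {0..scale 0})"

lemma cantor_gauge_dim_fun: "cantor_gauge \<in> dim_funs"
proof -
  let ?h = "restrict gauge_series {0..scale 0}"
  have pos: "0 < gauge_series x" if "0 < x" for x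
  proof (cases "x \<le> scale 0")
    case True
    show ?thesis using gauge_series_strict_mono[of 0 x] that scale_pos[of 0] gauge_series_0 by simp
  next
    case False
    then show ?thesis using gauge_series_strict_mono[of 0 x] that scale_pos[of 0] gauge_series_0 by simp
  qed
  have "continuous_on {0<..scale 0} ?h"
    using continuous_on_subset[OF continuous_gauge_series, of "{0<..scale 0}"]
    by (subst continuous_on_cong[OF refl, where g = gauge_series]) auto
  moreover have "strict_mono_on {0<..scale 0} ?h"
    by (auto simp: strict_mono_on_def intro!: gauge_series_strict_mono)
  moreover have "doubling (scale 0, ?h)"
    unfolding doubling_def prod.case
  proof (intro exI[of _ "1 / 4"] conjI allI impI)
    fix x assume "0 < x \<and> 2 * x \<le> scale 0"
    then show "1 / 4 * ?h (2 * x) \<le> ?h x" using gauge_series_doubling[of x] by simp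
  qed simp
  moreover have "(?h \<longlongrightarrow> 0) (at_right 0)"
  proof (rule Lim_transform_eventually)
    have "isCont gauge_series 0"
      using continuous_gauge_series by (simp add: continuous_on_eq_continuous_at)
    then show "(gauge_series \<longlongrightarrow> 0) (at_right 0)"
      unfolding isCont_def gauge_series_0 by (rule filterlim_mono[OF _ order_refl at_le]) simp
    show "\<forall>\<^sub>F x in at_right 0. gauge_series x = ?h x"
      unfolding eventually_at_right_field using scale_pos[of 0] by (intro exI[of _ "scale 0"]) auto
  qed
  ultimately show ?thesis
    using pos scale_pos[of 0]
    by (auto simp: cantor_gauge_def dim_funs_def inc_gauges_def gauge_series_0)
qed

lemma cantor_gauge_dyadic: "dyadic_gauge cantor_gauge"
proof -
  have "scale k \<in> {0..scale 0}" for k using scale_antimono[of 0 k] scale_pos[of k] by simp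
  then show ?thesis
    unfolding cantor_gauge_def
    by (intro dyadic_gaugeI[of 1 3 0 _ 0]) (simp_all add: gauge_series_scale_ge gauge_series_scale_le)
qed

end

section \<open>Geometry of the Cantor set\<close>

locale cantor_construction = cantor_sequence +
  fixes x0 :: real
begin

abbreviation "left \<equiv> cantor_left a x0"
abbreviation "len \<equiv> cantor_length a"
abbreviation "I \<equiv> cantor_interval a x0"
abbreviation "C \<equiv> cantor_set a x0"

lemma left_even: "1 \<le> n \<Longrightarrow> left (2 * n) = left n"
  and left_odd: "1 \<le> n \<Longrightarrow> left (2 * n + 1) = left n + len (2 * n) + a n"
  by (subst cantor_left.simps, simp)+

text \<open>Passing to the left child keeps the left endpoint, so the endpoints of one level remain
  available at every deeper level.\<close>

lemma left_pow: "1 \<le> n \<Longrightarrow> left (2 ^ p * n) = left n"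
proof (induction p)
  case (Suc p)
  then show ?case using left_even[of "2 ^ p * n"] by (simp add: mult.assoc)
qed simp

text \<open>The children of m are 2m and 2m + 1, so \<open>n div 2\<close> is the parent of
  \<open>n\<close> in the binary tree.\<close>

lemma I_div2: "2 \<le> n \<Longrightarrow> I n \<subseteq> I (n div 2)"
proof -
  assume n: "2 \<le> n"
  define m where "m = n div 2"
  have m: "1 \<le> m" using n by (simp add: m_def)
  have l: "0 < a m" "0 < len (2 * m)" "0 < len (2 * m + 1)" using m by (auto intro!: a_pos length_pos)
  have "n = 2 * m \<or> n = 2 * m + 1" unfolding m_def by linarith
  then have "I n \<subseteq> I m"
    using length_rec[OF m] left_even[OF m] left_odd[OF m] l
    by (elim disjE) (simp_all add: cantor_interval_def)
  then show ?thesis by (simp add: m_def)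
qed

lemma I_div_pow: "2 ^ p \<le> n \<Longrightarrow> I n \<subseteq> I (n div 2 ^ p)"
proof (induction p)
  case (Suc p)
  have "2 \<le> n div 2 ^ p" using Suc.prems by (simp add: less_eq_div_iff_mult_less_eq)
  then have "I (n div 2 ^ p) \<subseteq> I (n div 2 ^ p div 2)" by (rule I_div2)
  moreover have "I n \<subseteq> I (n div 2 ^ p)" using Suc by simp
  ultimately show ?case unfolding power_Suc2 div_mult2_eq by blast
qed simp

lemma left_in_I: "1 \<le> n \<Longrightarrow> left n \<in> I n"
  using length_pos[of n] by (simp add: cantor_interval_def)

text \<open>Siblings are separated by the gap of their parent. Otherwise the two are the right child
  of \<open>m\<close> and the left child of \<open>Suc m\<close>, and the claim is inherited from
  the parents.\<close>

lemma left_adjacent: "n \<in> level k \<Longrightarrow> Suc n \<in> level k \<Longrightarrow> left n + len n \<le> left (Suc n)"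
proof (induction k arbitrary: n)
  case (Suc k)
  define m where "m = n div 2"
  have m: "m \<in> level k" "1 \<le> m"
    using Suc.prems level_ge_1[of m k]
    by (auto simp: m_def less_eq_div_iff_mult_less_eq div_less_iff_less_mult)
  show ?case
  proof (cases "even n")
    case True
    then have n: "n = 2 * m" by (simp add: m_def)
    show ?thesis using left_even[OF m(2)] left_odd[OF m(2)] a_pos[OF m(2)] unfolding n by simp
  next
    case False
    then have n: "n = 2 * m + 1" "Suc n = 2 * Suc m" by (auto simp: m_def)
    have "Suc m \<in> level k" using Suc.prems(2) unfolding n(2) by (simp del: mult_Suc_right)
    then have "left m + len m \<le> left (Suc m)" using Suc.IH m by blast
    then show ?thesis
      using left_odd[OF m(2)] left_even[of "Suc m"] length_rec[OF m(2)] unfolding n(2) unfolding n(1) by simp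
  qed
qed auto

lemma left_separated: "m \<in> level k \<Longrightarrow> n \<in> level k \<Longrightarrow> m < n \<Longrightarrow> left m + len m \<le> left n"
proof (induction n)
  case (Suc n)
  show ?case
  proof (cases "m = n")
    case True
    then show ?thesis using Suc left_adjacent by blast
  next
    case False
    then have n: "m < n" "n \<in> level k" using Suc.prems by auto
    then have "left m + len m \<le> left n" using Suc by blast
    also have "\<dots> \<le> left n + len n" using length_pos[OF level_ge_1[OF n(2)]] by simp
    also have "\<dots> \<le> left (Suc n)" using n Suc.prems left_adjacent by blast
    finally show ?thesis .
  qed
qed simp

lemma left_mono: "m \<in> level k \<Longrightarrow> n \<in> level k \<Longrightarrow> m \<le> n \<Longrightarrow> left m \<le> left n"
  using left_separated[of m k n] length_pos[OF level_ge_1[of m k]] by (cases "m = n") auto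

text \<open>The indices from 2^p n to 2^p (n + 1) - 1 are the descendants of \<open>n\<close> after
  p generations.\<close>

lemma block_in_level: "n \<in> level k \<Longrightarrow> j \<in> {2 ^ p * n..<2 ^ p * Suc n} \<Longrightarrow> j \<in> level (k + p)"
proof -
  assume n: "n \<in> level k" and j: "j \<in> {2 ^ p * n..<2 ^ p * Suc n}"
  have "2 ^ p * 2 ^ k \<le> 2 ^ p * n" "2 ^ p * Suc n \<le> 2 ^ p * 2 ^ (k + 1)"
    using n by (intro mult_le_mono2; simp)+
  moreover have "2 ^ p * 2 ^ k = (2 ^ (k + p) :: nat)" "2 ^ p * 2 ^ (k + 1) = (2 ^ (k + p + 1) :: nat)"
    by (simp_all add: power_add)
  ultimately show ?thesis using j unfolding atLeastLessThan_iff by linarith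
qed

lemma left_block_in_I: "1 \<le> n \<Longrightarrow> j \<in> {2 ^ p * n..<2 ^ p * Suc n} \<Longrightarrow> left j \<in> I n"
proof -
  assume n: "1 \<le> n" and j: "j \<in> {2 ^ p * n..<2 ^ p * Suc n}"
  have "2 ^ p \<le> (2::nat) ^ p * n" using n by simp
  then have jp: "2 ^ p \<le> j" using j unfolding atLeastLessThan_iff by linarith
  have "j div 2 ^ p = n" using j by (intro div_nat_eqI) (auto simp: mult.commute)
  moreover have "1 \<le> j" using order_trans[OF _ jp] by simp
  ultimately show ?thesis using I_div_pow[OF jp] left_in_I[of j] by blast
qed

text \<open>At levels below that of \<open>n\<close> the leftmost descendant contains the point; at
  coarser levels an ancestor does.\<close>

lemma left_in_C: "1 \<le> n \<Longrightarrow> left n \<in> C"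
proof -
  assume n: "1 \<le> n"
  obtain K where K: "n \<in> level K" using ex_power_ivl1[of 2 n] n by auto
  have "\<exists>m\<in>level k. left n \<in> I m" for k
  proof (cases "K \<le> k")
    case True
    have "2 ^ (k - K) * n \<in> level (K + (k - K))" using block_in_level[OF K, of _ "k - K"] by simp
    moreover have "left n \<in> I (2 ^ (k - K) * n)"
      using left_in_I[of "2 ^ (k - K) * n"] left_pow[OF n, of "k - K"] n by simp
    ultimately show ?thesis using True by auto
  next
    case False
    define p where "p = K - k"
    have Kp: "K = k + p" using False by (simp add: p_def)
    have "2 ^ k \<le> n div 2 ^ p" "n div 2 ^ p < 2 ^ (k + 1)"
      using K unfolding Kp
      by (auto simp: less_eq_div_iff_mult_less_eq div_less_iff_less_mult power_add mult_ac)
    moreover have "2 ^ p \<le> n"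
    proof -
      have "(2::nat) ^ p \<le> 2 ^ (k + p)" by (intro power_increasing) auto
      then show ?thesis using K unfolding Kp atLeastLessThan_iff by linarith
    qed
    ultimately show ?thesis using I_div_pow[of p n] left_in_I[OF n] by (intro bexI[of _ "n div 2 ^ p"]) auto
  qed
  then show ?thesis unfolding cantor_set_def by blast
qed

lemma C_memE:
  assumes "x \<in> C"
  obtains n where "n \<in> level k" "x \<in> I n"
proof -
  have "x \<in> (\<Union>n\<in>level k. I n)" using assms unfolding cantor_set_def by blast
  then show ?thesis using that by blast
qed

lemma closed_C: "closed C"
  unfolding cantor_set_def cantor_interval_def by (intro closed_INT ballI closed_UN) auto

section \<open>Measures of the Cantor set\<close>

text \<open>A set of diameter below every length of level \<open>k\<close> cannot contain points on both sides of a
  complete interval of that level, so it meets the left endpoints of two consecutive blocks at most.\<close>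

lemma card_left_in_small_set:
  assumes kK: "k \<le> K" and small: "\<And>y z. y \<in> V \<Longrightarrow> z \<in> V \<Longrightarrow> \<bar>y - z\<bar> < scale (Suc k)"
  shows "card {j \<in> level K. left j \<in> V} \<le> 2 * 2 ^ (K - k)"
proof (cases "{j \<in> level K. left j \<in> V} = {}")
  case True
  then show ?thesis by (simp only: card.empty)
next
  case False
  define J where "J = {j \<in> level K. left j \<in> V}"
  define j0 where "j0 = Min J"
  define p where "p = K - k"
  have K: "K = k + p" using kK by (simp add: p_def)
  have fin: "finite J" unfolding J_def by auto
  have j0: "j0 \<in> J" using False Min_in[OF fin] unfolding j0_def J_def by blast
  have "J \<subseteq> {j0..<j0 + 2 * 2 ^ p}"
  proof
    fix j assume j: "j \<in> J"
    have "j0 \<le> j" unfolding j0_def using fin j by simp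
    moreover have "j < j0 + 2 * 2 ^ p"
    proof (rule ccontr)
      assume "\<not> j < j0 + 2 * 2 ^ p"
      then have far: "j0 + 2 * 2 ^ p \<le> j" by simp
      \<comment> \<open>The block following that of \<open>j0\<close>. Two block lengths of distance
        force this whole block to end before \<open>j\<close>, so the interval \<open>i\<close>
        separates the two endpoints.\<close>
      define i where "i = Suc (j0 div 2 ^ p)"
      have mod: "2 ^ p * (j0 div 2 ^ p) + j0 mod 2 ^ p = j0" "j0 mod 2 ^ p < 2 ^ p" by auto
      have i1: "j0 \<le> 2 ^ p * i" using mod unfolding i_def mult_Suc_right by linarith
      have i2: "2 ^ p * Suc i \<le> j" using far mod unfolding i_def mult_Suc_right by linarith
      have lev: "j0 \<in> level K" "j \<in> level K" using j j0 by (auto simp: J_def)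
      have "2 ^ k * 2 ^ p \<le> j0" using lev(1) unfolding K by (simp add: power_add)
      then have i3: "2 ^ k \<le> i" unfolding i_def by (simp add: less_eq_div_iff_mult_less_eq le_SucI)
      have "(2::nat) ^ (K + 1) = 2 ^ p * 2 ^ (k + 1)" by (simp add: K power_add)
      then have "j < 2 ^ p * 2 ^ (k + 1)" using lev(2) unfolding atLeastLessThan_iff by simp
      with i2 have "2 ^ p * Suc i < 2 ^ p * 2 ^ (k + 1)" by (rule le_less_trans)
      then have i4: "Suc i < 2 ^ (k + 1)" by (simp only: nat_mult_less_cancel_disj)
      have ilev: "i \<in> level k" "Suc i \<in> level k" using i3 i4 by auto
      have blev: "2 ^ p * i \<in> level K" "2 ^ p * Suc i \<in> level K"
        unfolding K by (rule block_in_level[OF ilev(1)], simp) (rule block_in_level[OF ilev(2)], simp)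
      have "left j0 \<le> left (2 ^ p * i)" by (rule left_mono[OF lev(1) blev(1) i1])
      also have "\<dots> = left i" by (rule left_pow[OF level_ge_1[OF ilev(1)]])
      finally have "left j0 + len i \<le> left (Suc i)" using left_adjacent[OF ilev] by linarith
      also have "\<dots> = left (2 ^ p * Suc i)" by (rule left_pow[symmetric]) simp
      also have "\<dots> \<le> left j" by (rule left_mono[OF blev(2) lev(2) i2])
      finally have "scale (Suc k) \<le> left j - left j0" using scale_le_length[OF ilev(1)] by linarith
      then show False using small[of "left j" "left j0"] j j0 by (auto simp: J_def)
    qed
    ultimately show "j \<in> {j0..<j0 + 2 * 2 ^ p}" by simp
  qed
  from card_mono[OF _ this] show ?thesis by (simp add: J_def p_def)
qed

text \<open>Mass distribution, with the uniform mass of level \<open>K\<close> placed on its left endpoints: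
  compactness makes a cover finite, and then one \<open>K\<close> serves all its members.\<close>

lemma hausdorff_content_cantor_pos:
  assumes D: "(A, h) \<in> dim_funs" and c: "c > 0" and P: "scale P \<le> A"
    and lower: "\<And>k. P \<le> k \<Longrightarrow> c / 2 ^ k \<le> h (scale k)"
  shows "ennreal (c / 16) \<le> hausdorff_content h (scale (P + 2)) C"
  unfolding hausdorff_content_def
proof (rule Inf_greatest, clarify)
  note h = dim_funsD[OF D]
  fix U :: "nat \<Rightarrow> real set"
  assume cover: "C \<subseteq> (\<Union>i. U i)" and U: "\<forall>i. bounded (U i) \<and> diameter (U i) \<le> scale (P + 2)"
  define d where "d i = diameter (U i)" for i
  have PA: "scale (P + 1) \<le> A" using P scale_antimono[of P "P + 1"] by simp
  \<comment> \<open>The room between these two scales allows each covering set to be thickened while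
    staying below \<open>scale (P + 1)\<close>.\<close>
  have half: "scale (P + 2) < scale (P + 1)"
    using scale_Suc_le[of "P + 1"] scale_pos[of "P + 1"] by simp
  have d: "0 \<le> d i" "d i < scale (P + 1)" for i
  proof -
    show "0 \<le> d i" unfolding d_def using U diameter_ge_0 by blast
    have "d i \<le> scale (P + 2)" unfolding d_def using U by blast
    then show "d i < scale (P + 1)" using half by (rule le_less_trans)
  qed
  have "\<exists>e. d i < e \<and> e \<le> scale (P + 1) \<and> h e \<le> h (d i) + c / 16 * (1 / 2) ^ Suc i" for i
  proof -
    have "0 < c / 16 * (1 / 2) ^ Suc i" using c by simp
    then obtain e where "d i < e" "e \<le> scale (P + 1)" "h e \<le> h (d i) + c / 16 * (1 / 2) ^ Suc i"
      by (rule right_continuous_gauge[OF D d(1) d(2) PA])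
    then show ?thesis by blast
  qed
  then obtain e where e: "\<And>i. d i < e i" "\<And>i. e i \<le> scale (P + 1)"
    "\<And>i. h (e i) \<le> h (d i) + c / 16 * (1 / 2) ^ Suc i" by metis
  \<comment> \<open>The bracket is shifted by one level so that its upper end is the threshold
    \<open>scale (Suc k)\<close> of the counting lemma.\<close>
  have "\<exists>k\<ge>P. scale (k + 2) < e i \<and> e i \<le> scale (Suc k)" for i
  proof -
    obtain k where "P + 1 \<le> k" "scale (Suc k) < e i" "e i \<le> scale k"
      by (rule scale_bracketE[OF le_less_trans[OF d(1) e(1)] e(2)])
    then show ?thesis by (intro exI[of _ "k - 1"]) auto
  qed
  then obtain \<kappa> where \<kappa>: "\<And>i. P \<le> \<kappa> i" "\<And>i. scale (\<kappa> i + 2) < e i" "\<And>i. e i \<le> scale (Suc (\<kappa> i))" by metis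
  \<comment> \<open>An open neighbourhood of \<open>U i\<close> whose points are less than
    \<open>e i\<close> apart: the margin on each side is half of \<open>e i - d i\<close>.\<close>
  define V where "V i = (\<Union>x\<in>U i. ball x ((e i - d i) / 2))" for i
  have V: "\<bar>y - z\<bar> < e i" if yV: "y \<in> V i" and zV: "z \<in> V i" for y z i
  proof -
    obtain y' where "y' \<in> U i" "y \<in> ball y' ((e i - d i) / 2)" using yV unfolding V_def by blast
    moreover obtain z' where "z' \<in> U i" "z \<in> ball z' ((e i - d i) / 2)" using zV unfolding V_def by blast
    ultimately have yz: "y' \<in> U i" "z' \<in> U i" "dist y' y < (e i - d i) / 2" "dist z' z < (e i - d i) / 2"
      unfolding mem_ball by blast+
    have "dist y' z' \<le> d i" using diameter_bounded_bound[of "U i"] U yz by (auto simp: d_def)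
    then show ?thesis using yz(3,4) by (simp add: dist_real_def abs_if split: if_splits)
  qed
  have UV: "U i \<subseteq> V i" for i using e(1)[of i] by (force simp: V_def)
  have "C \<subseteq> I 1"
  proof
    fix x assume "x \<in> C"
    then obtain n where "n \<in> level 0" "x \<in> I n" by (rule C_memE)
    moreover from this have "n = 1" by auto
    ultimately show "x \<in> I 1" by simp
  qed
  then have "compact C"
    using closed_C bounded_subset[of "I 1" C] by (auto simp: compact_eq_bounded_closed cantor_interval_def)
  moreover have "open (V i)" for i by (auto simp: V_def)
  moreover have "C \<subseteq> (\<Union>i\<in>UNIV. V i)" by (rule order_trans[OF cover]) (intro UN_mono UV order_refl)
  ultimately obtain F where F: "finite F" "C \<subseteq> (\<Union>i\<in>F. V i)"
    by (rule compactE_image)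
  define K where "K = Max (insert 0 (\<kappa> ` F))"
  have K: "\<kappa> i \<le> K" if "i \<in> F" for i using that F(1) by (simp add: K_def)
  define J where "J i = {j \<in> level K. left j \<in> V i}" for i
  have "level K \<subseteq> (\<Union>i\<in>F. J i)" using F(2) left_in_C level_ge_1[of _ K] unfolding J_def by blast
  then have "card (level K) \<le> card (\<Union>i\<in>F. J i)" using F(1) by (intro card_mono) (auto simp: J_def)
  also have "\<dots> \<le> (\<Sum>i\<in>F. card (J i))" by (rule card_UN_le[OF F(1)])
  finally have "real (2 ^ K) \<le> (\<Sum>i\<in>F. real (card (J i)))" by (simp flip: of_nat_sum)
  also have "\<dots> \<le> (\<Sum>i\<in>F. 8 * 2 ^ K / c * h (e i))"
  proof (rule sum_mono)
    fix i assume i: "i \<in> F"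
    have "card (J i) \<le> 2 * 2 ^ (K - \<kappa> i)"
      unfolding J_def using V[of _ i] \<kappa>(3)[of i] by (intro card_left_in_small_set K i) force
    then have "real (card (J i)) \<le> real (2 * 2 ^ (K - \<kappa> i))" by (rule of_nat_mono)
    also have "\<dots> = 2 * (2::real) ^ (K - \<kappa> i)" by simp
    also have "\<dots> = 8 * 2 ^ K / c * (c / 2 ^ (\<kappa> i + 2))"
      using K[OF i] c by (simp add: power_diff)
    also have "\<dots> \<le> 8 * 2 ^ K / c * h (scale (\<kappa> i + 2))"
      using c \<kappa>(1)[of i] by (intro mult_left_mono lower) auto
    also have "\<dots> \<le> 8 * 2 ^ K / c * h (e i)"
      using c \<kappa>(2)[of i] e(2)[of i] PA by (intro mult_left_mono h(4) less_imp_le[OF scale_pos]) auto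
    finally show "real (card (J i)) \<le> 8 * 2 ^ K / c * h (e i)" .
  qed
  also have "\<dots> = 8 * 2 ^ K / c * (\<Sum>i\<in>F. h (e i))" by (rule sum_distrib_left[symmetric])
  finally have "c / 8 \<le> (\<Sum>i\<in>F. h (e i))" using c by (simp add: field_simps)
  \<comment> \<open>All thickenings together cost at most c/16, which leaves half of the bound
    c/8.\<close>
  also have "\<dots> \<le> (\<Sum>i\<in>F. h (d i) + c / 16 * (1 / 2) ^ Suc i)" by (rule sum_mono) (rule e)
  also have "\<dots> = (\<Sum>i\<in>F. h (d i)) + c / 16 * (\<Sum>i\<in>F. (1 / 2) ^ Suc i)"
    by (simp add: sum.distrib sum_distrib_left)
  also have "(\<Sum>i\<in>F. (1 / 2) ^ Suc i) \<le> (1::real)"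
    using sum_le_suminf[OF sums_summable[OF power_half_series] F(1)] sums_unique[OF power_half_series] by auto
  finally have "c / 16 \<le> (\<Sum>i\<in>F. h (d i))" using c by simp
  then have "ennreal (c / 16) \<le> ennreal (\<Sum>i\<in>F. h (d i))" by (rule ennreal_leI)
  also have "\<dots> = (\<Sum>i\<in>F. ennreal (h (d i)))"
  proof (rule sum_ennreal[symmetric])
    show "0 \<le> h (d i)" for i using h(4)[of 0 "d i"] h(2) d[of i] PA by simp
  qed
  also have "\<dots> \<le> (\<Sum>i. ennreal (h (d i)))"
    using F(1) by (intro sum_le_suminf) auto
  finally show "ennreal (c / 16) \<le> (\<Sum>i. ennreal (h (diameter (U i))))" unfolding d_def .
qed

text \<open>The interval of level \<open>p + 2\<close> around \<open>x\<close> is shorter than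
  \<open>r\<close>, so it lies in the ball together with the endpoints of all its
  descendants.\<close>

lemma card_left_in_ball:
  assumes x: "x \<in> C" and r: "scale (Suc p) < r" and K: "p + 2 \<le> K"
  shows "2 ^ (K - (p + 2)) \<le> card {j \<in> level K. left j \<in> ball x r}"
proof -
  define q where "q = K - (p + 2)"
  have Kq: "K = p + 2 + q" using K by (simp add: q_def)
  obtain i where i: "i \<in> level (p + 2)" "x \<in> I i" using C_memE[OF x] .
  have "len i \<le> scale (Suc p)" using i(1) by (intro length_le_scale) simp
  then have "I i \<subseteq> ball x r" using i(2) r by (auto simp: cantor_interval_def dist_real_def abs_if)
  then have "{2 ^ q * i..<2 ^ q * Suc i} \<subseteq> {j \<in> level K. left j \<in> ball x r}"
    using block_in_level[OF i(1), of _ q] left_block_in_I[OF level_ge_1[OF i(1)], of _ q] unfolding Kq by blast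
  from card_mono[OF _ this] show ?thesis by (simp add: q_def)
qed

text \<open>Disjoint balls share the 2^K left endpoints of level K, and each ball B receives a
  proportion of at least h(|B|)/(8c).\<close>

lemma packing_premeas_cantor_le:
  assumes D: "(A, h) \<in> dim_funs" and c: "c > 0" and P: "scale P \<le> A"
    and upper: "\<And>k. P \<le> k \<Longrightarrow> h (scale k) \<le> c / 2 ^ k"
  shows "packing_premeas h C \<le> ennreal (8 * c)"
proof -
  note h = dim_funsD[OF D]
  have "packing_content h (scale (Suc P)) C \<le> ennreal (8 * c)"
    unfolding packing_content_def
  proof (rule SUP_least)
    fix \<B> assume \<B>: "\<B> \<in> packings (scale (Suc P)) C"
    define J where "J K B = {j \<in> level K. left j \<in> B}" for K B
    have "\<exists>k0. \<forall>K\<ge>k0. h (diameter B) * 2 ^ K \<le> 8 * c * real (card (J K B))" if B: "B \<in> \<B>" for B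
    proof -
      obtain x r where xr: "x \<in> C" "0 < r" "B = ball x r" "diameter B < scale (Suc P)"
        using \<B> B unfolding packings_def by blast
      then have r: "diameter B = 2 * r" "2 * r < scale (Suc P)" by auto
      have "r \<le> scale (Suc P)" using r xr(2) by simp
      then obtain p where p: "Suc P \<le> p" "scale (Suc p) < r" "r \<le> scale p"
        by (rule scale_bracketE[OF xr(2)])
      \<comment> \<open>The diameter 2r is compared with level p - 1, while endpoints are counted
        from level p + 2; these three levels account for the factor 8.\<close>
      have "2 * r \<le> scale (p - 1)" using p scale_Suc_le[of "p - 1"] by simp
      moreover have "scale (p - 1) \<le> A" using scale_antimono[of P "p - 1"] P p(1) by linarith
      ultimately have "h (2 * r) \<le> h (scale (p - 1))" using xr(2) by (intro h(4)) auto
      also have "\<dots> \<le> c / 2 ^ (p - 1)" using p(1) by (intro upper) simp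
      finally have hr: "h (2 * r) \<le> c / 2 ^ (p - 1)" .
      have "h (2 * r) * 2 ^ K \<le> 8 * c * real (card (J K B))" if K: "p + 2 \<le> K" for K
      proof -
        have "h (2 * r) * 2 ^ K \<le> c / 2 ^ (p - 1) * 2 ^ K" using hr by (intro mult_right_mono) auto
        also have "\<dots> = 8 * c * real (2 ^ (K - (p + 2)))"
        proof -
          define p' K' where "p' = p - 1" and "K' = K - (p + 2)"
          have "p = Suc p'" "K = p' + 3 + K'" using p(1) K by (simp_all add: p'_def K'_def)
          then show ?thesis by (simp add: power_add)
        qed
        also have "\<dots> \<le> 8 * c * real (card (J K B))"
          using c card_left_in_ball[OF xr(1) p(2) K] unfolding J_def xr(3)
          by (intro mult_left_mono of_nat_mono) auto
        finally show ?thesis .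
      qed
      then show ?thesis unfolding r(1) by blast
    qed
    then obtain k0 where k0: "\<And>B K. B \<in> \<B> \<Longrightarrow> k0 B \<le> K \<Longrightarrow> h (diameter B) * 2 ^ K \<le> 8 * c * real (card (J K B))"
      by metis
    have hpos: "0 \<le> h (diameter B)" if "B \<in> \<B>" for B
    proof -
      have "diameter B < scale (Suc P)" using \<B> that unfolding packings_def by blast
      moreover have "0 \<le> diameter B"
      proof -
        have "bounded B" using \<B> that unfolding packings_def by auto
        then show ?thesis by (rule diameter_ge_0)
      qed
      ultimately show ?thesis
        using h(4)[of 0 "diameter B"] h(2) P scale_antimono[of P "Suc P"] by simp
    qed
    have "(\<Sum>\<^sub>\<infinity>B\<in>\<B>. ennreal (h (diameter B))) = (SUP F\<in>{F. finite F \<and> F \<subseteq> \<B>}. \<Sum>B\<in>F. ennreal (h (diameter B)))"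
      by (rule nonneg_infsum_complete) auto
    also have "\<dots> \<le> ennreal (8 * c)"
    proof (rule SUP_least, clarify)
      fix F assume F: "finite F" "F \<subseteq> \<B>"
      \<comment> \<open>The infinite sum is a supremum of finite ones, and finitely many balls have
        a common level beyond all their thresholds.\<close>
      define K where "K = Max (insert 0 (k0 ` F))"
      have K: "k0 B \<le> K" if "B \<in> F" for B using that F(1) by (simp add: K_def)
      have "(\<Sum>B\<in>F. h (diameter B)) * 2 ^ K \<le> (\<Sum>B\<in>F. 8 * c * real (card (J K B)))"
        unfolding sum_distrib_right using k0 K F(2) by (intro sum_mono) blast
      also have "\<dots> = 8 * c * real (\<Sum>B\<in>F. card (J K B))" by (simp add: sum_distrib_left)
      also have "(\<Sum>B\<in>F. card (J K B)) = card (\<Union>B\<in>F. J K B)"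
      proof (rule card_UN_disjoint[symmetric, OF F(1)])
        show "\<forall>B\<in>F. \<forall>B'\<in>F. B \<noteq> B' \<longrightarrow> J K B \<inter> J K B' = {}"
          using \<B> F(2) unfolding packings_def disjoint_def J_def by blast
      qed (auto simp: J_def)
      also have "\<dots> \<le> card (level K)" by (rule card_mono) (auto simp: J_def)
      finally have "(\<Sum>B\<in>F. h (diameter B)) * 2 ^ K \<le> 8 * c * real (card (level K))"
        using c by (simp add: mult_left_mono)
      then have "(\<Sum>B\<in>F. h (diameter B)) \<le> 8 * c" by simp
      moreover have "(\<Sum>B\<in>F. ennreal (h (diameter B))) = ennreal (\<Sum>B\<in>F. h (diameter B))"
        using F(2) hpos by (intro sum_ennreal) blast
      ultimately show "(\<Sum>B\<in>F. ennreal (h (diameter B))) \<le> ennreal (8 * c)" by (simp add: ennreal_leI)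
    qed
    finally show "(\<Sum>\<^sub>\<infinity>B\<in>\<B>. ennreal (h (diameter B))) \<le> ennreal (8 * c)" .
  qed
  then show ?thesis unfolding packing_premeas_eq_INF by (intro INF_lower2) (auto intro: scale_pos)
qed

section \<open>Bounds on the gauge forced by regularity\<close>

lemma lower_bound_of_hausdorff_pos:
  assumes D: "(A, h) \<in> dim_funs" and pos: "0 < hausdorff_meas h C"
  obtains P c where "0 < c" "scale P \<le> A" "\<And>k. P \<le> k \<Longrightarrow> c / 2 ^ k \<le> h (scale k)"
proof -
  note h = dim_funsD[OF D]
  obtain \<delta> where \<delta>: "0 < \<delta>" "0 < hausdorff_content h \<delta> C"
    using pos unfolding hausdorff_meas_eq_SUP less_SUP_iff by auto
  obtain P where P: "scale P < min \<delta> A"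
    by (rule scale_lessE[of "min \<delta> A" 0]) (use \<delta> h(1) in simp)
  \<comment> \<open>The 2^(k+1) intervals of level \<open>Suc k\<close> have length at most
    \<open>scale k\<close> and cover \<open>C\<close>. The content on the left is taken at one fixed
    \<delta>, where it is positive.\<close>
  have bound: "hausdorff_content h \<delta> C \<le> ennreal (2 * 2 ^ k * h (scale k))" if k: "P \<le> k" for k
  proof -
    have sk: "scale k \<le> \<delta>" "scale k \<le> A" using scale_antimono[OF k] P by auto
    have len: "0 \<le> len n" "len n \<le> scale k" "diameter (I n) = len n" if "n \<in> level (Suc k)" for n
      using length_le_scale[OF that] length_pos[OF level_ge_1[OF that]] by (auto simp: cantor_interval_def)
    have "hausdorff_content h \<delta> C \<le> hausdorff_content h (scale k) C"
      by (rule hausdorff_content_antimono[OF sk(1)])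
    also have "\<dots> \<le> (\<Sum>n\<in>level (Suc k). ennreal (h (diameter (I n))))"
    proof (rule hausdorff_content_le_sum)
      show "h 0 = 0" by (rule h(2))
      show "C \<subseteq> (\<Union>n\<in>level (Suc k). I n)" unfolding cantor_set_def by blast
      show "0 \<le> scale k" using scale_pos[of k] by simp
      fix n assume "n \<in> level (Suc k)"
      then show "bounded (I n) \<and> diameter (I n) \<le> scale k"
        using len by (simp add: cantor_interval_def)
    qed simp
    also have "\<dots> \<le> (\<Sum>n\<in>level (Suc k). ennreal (h (scale k)))"
    proof (intro sum_mono ennreal_leI)
      fix n assume n: "n \<in> level (Suc k)"
      show "h (diameter (I n)) \<le> h (scale k)" unfolding len(3)[OF n] by (rule h(4)[OF len(1,2)[OF n] sk(2)])
    qed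
    also have "\<dots> = ennreal (\<Sum>n\<in>level (Suc k). h (scale k))"
      by (rule sum_ennreal) (rule less_imp_le[OF h(3)[OF scale_pos sk(2)]])
    finally show ?thesis by (simp add: mult.assoc)
  qed
  have "hausdorff_content h \<delta> C < top"
    using bound[of P] by (auto intro: le_less_trans)
  then obtain c' where c': "0 \<le> c'" "hausdorff_content h \<delta> C = ennreal c'"
    by (cases "hausdorff_content h \<delta> C") auto
  have c'pos: "0 < c'" using \<delta>(2) unfolding c'(2) by simp
  show ?thesis
  proof (rule that[of "c' / 2" P])
    show "0 < c' / 2" using c'pos by simp
    show "scale P \<le> A" using P by simp
    fix k assume k: "P \<le> k"
    have "scale k \<le> A" using scale_antimono[OF k] P by simp
    then have "0 < h (scale k)" by (rule h(3)[OF scale_pos])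
    then have "c' \<le> 2 * 2 ^ k * h (scale k)"
      using bound[OF k] unfolding c'(2) by (subst (asm) ennreal_le_iff) auto
    then show "c' / 2 / 2 ^ k \<le> h (scale k)" by (simp add: field_simps)
  qed
qed

text \<open>If no closure of a piece had interior relative to \<open>C\<close>, their complements
  would be dense and relatively open in \<open>C\<close> with empty intersection, against Baire. A
  small enough interval then fits into the interior found.\<close>

lemma countable_cover_dense_in_interval:
  fixes F :: "nat \<Rightarrow> real set"
  assumes F: "C = (\<Union>i. F i)"
  obtains i m n where "n \<in> level m" "C \<inter> I n \<subseteq> closure (F i)"
proof -
  define \<G> where "\<G> = range (\<lambda>i. C \<inter> - closure (F i))"
  have "\<Inter>\<G> = {}"
  proof (rule ccontr)
    assume "\<Inter>\<G> \<noteq> {}"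
    then obtain x where x: "\<And>i. x \<in> C \<inter> - closure (F i)" unfolding \<G>_def by blast
    then obtain i where "x \<in> F i" using F by blast
    then show False using x[of i] closure_subset[of "F i"] by blast
  qed
  moreover have "C \<noteq> {}" using left_in_C[of 1] by auto
  ultimately have "\<not> C \<subseteq> closure (\<Inter>\<G>)" by simp
  then obtain T where "T \<in> \<G>" "\<not> (openin (top_of_set C) T \<and> C \<subseteq> closure T)"
    using Baire[OF closed_C, of \<G>] unfolding \<G>_def by blast
  then obtain i where "\<not> C \<subseteq> closure (C \<inter> - closure (F i))"
    unfolding \<G>_def by (auto simp: openin_open_Int open_Compl)
  then obtain x where x: "x \<in> C" "x \<notin> closure (C \<inter> - closure (F i))" by blast
  then obtain e where e: "0 < e" "\<And>y. y \<in> C \<inter> - closure (F i) \<Longrightarrow> e \<le> dist y x"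
    unfolding closure_approachable by (meson not_less)
  obtain m where m: "scale m < e" using scale_lessE[OF e(1)] .
  obtain n where n: "n \<in> level (Suc m)" "x \<in> I n" using C_memE[OF x(1)] .
  have "len n < e" using length_le_scale[OF n(1)] m by simp
  have "C \<inter> I n \<subseteq> closure (F i)"
  proof
    fix y assume y: "y \<in> C \<inter> I n"
    have "dist y x < e"
      using y n(2) \<open>len n < e\<close> by (auto simp: cantor_interval_def dist_real_def abs_if)
    then show "y \<in> closure (F i)" using e(2)[of y] y by force
  qed
  then show ?thesis using that n(1) by blast
qed

text \<open>The descendants of \<open>n\<close> at level k - 1 have length at least
  \<open>scale k\<close>, so their left endpoints are that far apart. Density moves the centres into
  \<open>F i\<close>, and the resulting packing bounds the number of balls times
  \<open>h (scale k / 2)\<close>; doubling recovers \<open>h (scale k)\<close>.\<close>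

lemma upper_bound_of_packing_finite:
  assumes D: "(A, h) \<in> dim_funs" and fin: "packing_meas h C < \<infinity>"
  obtains P c where "0 < c" "scale P \<le> A" "\<And>k. P \<le> k \<Longrightarrow> h (scale k) \<le> c / 2 ^ k"
proof -
  note h = dim_funsD[OF D]
  obtain d where d: "d > 0" "\<And>x. 0 < x \<Longrightarrow> 2 * x \<le> A \<Longrightarrow> h (2 * x) \<le> d * h x"
    using doublingE[OF D] by metis
  obtain F :: "nat \<Rightarrow> real set" where F: "C = (\<Union>i. F i)" "(\<Sum>i. packing_premeas h (F i)) < \<infinity>"
    using fin unfolding packing_meas_def Inf_less_iff by blast
  obtain i m n where n: "n \<in> level m" "C \<inter> I n \<subseteq> closure (F i)"
    by (rule countable_cover_dense_in_interval[OF F(1)])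
  have "packing_premeas h (F i) < \<infinity>"
    using F(2) by (metis ennreal_suminf_lessD infinity_ennreal_def)
  then obtain \<delta> where \<delta>: "0 < \<delta>" "packing_content h \<delta> (F i) < \<infinity>"
    unfolding packing_premeas_eq_INF INF_less_iff by auto
  then obtain M where M: "0 \<le> M" "packing_content h \<delta> (F i) = ennreal M"
    by (cases "packing_content h \<delta> (F i)") auto
  obtain P where P: "Suc m \<le> P" "scale P < min \<delta> A"
    by (rule scale_lessE[of "min \<delta> A" "Suc m"]) (use \<delta> h(1) in auto)
  have main: "h (scale k) \<le> 2 ^ Suc m * d * M / 2 ^ k" if k: "P \<le> k" for k
  proof -
    define q where "q = k - Suc m"
    have kq: "k = Suc (m + q)" using k P(1) by (simp add: q_def)
    define s where "s = scale k"
    have s: "0 < s" "s < \<delta>" "s \<le> A" using scale_pos[of k] scale_antimono[OF k] P(2) by (auto simp: s_def)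
    define B where "B = {2 ^ q * n..<2 ^ q * Suc n}"
    have Blev: "j \<in> level (m + q)" "left j \<in> closure (F i)" if "j \<in> B" for j
    proof -
      show lev: "j \<in> level (m + q)" using block_in_level[OF n(1)] that unfolding B_def .
      have "left j \<in> I n" using left_block_in_I[OF level_ge_1[OF n(1)]] that unfolding B_def .
      then show "left j \<in> closure (F i)" using n(2) left_in_C[OF level_ge_1[OF lev]] by blast
    qed
    have "0 < s / 4" using s(1) by simp
    then have "\<forall>j\<in>B. \<exists>z\<in>F i. dist z (left j) < s / 4"
      using Blev(2) unfolding closure_approachable by blast
    then obtain z where z: "\<And>j. j \<in> B \<Longrightarrow> z j \<in> F i" "\<And>j. j \<in> B \<Longrightarrow> dist (z j) (left j) < s / 4"
      by metis
    define \<beta> where "\<beta> j = ball (z j) (s / 4)" for j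
    have disj: "\<beta> j \<inter> \<beta> j' = {}" if jj: "j \<in> B" "j' \<in> B" "j < j'" for j j'
    proof -
      have "left j + len j \<le> left j'" using left_separated Blev(1) jj by blast
      moreover have "s \<le> len j" unfolding s_def kq by (rule scale_le_length[OF Blev(1)[OF jj(1)]])
      ultimately have "s \<le> left j' - left j" by simp
      \<comment> \<open>Each centre moves by less than s/4, so two centres remain more than s/2
        apart, which is the sum of the radii.\<close>
      moreover have "\<bar>z j - left j\<bar> < s / 4" "\<bar>z j' - left j'\<bar> < s / 4"
        using z(2)[OF jj(1)] z(2)[OF jj(2)] by (simp_all only: dist_real_def)
      ultimately have False if "\<bar>z j - x\<bar> < s / 4" "\<bar>z j' - x\<bar> < s / 4" for x
        using that unfolding abs_less_iff by linarith
      then show ?thesis unfolding \<beta>_def ball_def dist_real_def by blast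
    qed
    have disj': "\<beta> j \<inter> \<beta> j' = {}" if "j \<in> B" "j' \<in> B" "j \<noteq> j'" for j j'
      using disj[of j j'] disj[of j' j] that by (cases j j' rule: linorder_cases) blast+
    have ne: "\<beta> j \<noteq> {}" for j using s(1) by (simp add: \<beta>_def)
    have inj: "inj_on \<beta> B" using disj' ne by (intro inj_onI) (metis Int_absorb)
    have diam: "diameter (\<beta> j) = s / 2" for j using s(1) by (simp add: \<beta>_def)
    have "\<beta> ` B \<in> packings \<delta> (F i)"
      unfolding packings_def
    proof (intro CollectI conjI ballI)
      show "disjoint (\<beta> ` B)" unfolding disjoint_def using disj' by blast
      fix X assume "X \<in> \<beta> ` B"
      then obtain j where j: "j \<in> B" "X = \<beta> j" by blast
      show "\<exists>x\<in>F i. \<exists>r>0. X = ball x r \<and> diameter X < \<delta>"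
      proof (intro bexI exI conjI)
        show "X = ball (z j) (s / 4)" unfolding j(2) \<beta>_def ..
        show "diameter X < \<delta>" unfolding j(2) diam using s by simp
      qed (use s(1) z(1)[OF j(1)] in auto)
    qed
    then have "(\<Sum>\<^sub>\<infinity>X\<in>\<beta> ` B. ennreal (h (diameter X))) \<le> packing_content h \<delta> (F i)"
      unfolding packing_content_def by (rule SUP_upper)
    moreover have "(\<Sum>\<^sub>\<infinity>X\<in>\<beta> ` B. ennreal (h (diameter X))) = (\<Sum>j\<in>B. ennreal (h (s / 2)))"
      unfolding infsum_reindex[OF inj] comp_def diam by (rule infsum_finite) (simp add: B_def)
    moreover have hs: "0 < h (s / 2)" using s by (intro h(3)) auto
    moreover have "(\<Sum>j\<in>B. ennreal (h (s / 2))) = ennreal (\<Sum>j\<in>B. h (s / 2))"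
      using hs by (intro sum_ennreal) simp
    ultimately have "ennreal (\<Sum>j\<in>B. h (s / 2)) \<le> ennreal M" unfolding M(2) by simp
    then have "(\<Sum>j\<in>B. h (s / 2)) \<le> M" using M(1) by (simp only: ennreal_le_iff)
    moreover have "card B = 2 ^ q" by (simp add: B_def)
    ultimately have "2 ^ q * h (s / 2) \<le> M" by simp
    have "h s \<le> d * h (s / 2)" using d(2)[of "s / 2"] s by simp
    have "2 ^ q * h s \<le> 2 ^ q * (d * h (s / 2))"
      using \<open>h s \<le> d * h (s / 2)\<close> by (rule mult_left_mono) simp
    also have "\<dots> = d * (2 ^ q * h (s / 2))" by simp
    also have "\<dots> \<le> d * M" using \<open>2 ^ q * h (s / 2) \<le> M\<close> d(1) by (intro mult_left_mono) auto
    finally have "2 ^ q * h s \<le> d * M" .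
    then show ?thesis unfolding s_def[symmetric] by (simp add: kq power_add field_simps)
  qed
  show ?thesis
  \<comment> \<open>Only \<open>0 \<le> M\<close> is at hand; adding 1 makes the constant
    positive.\<close>
  proof (rule that[of "2 ^ Suc m * d * M + 1" P])
    show "0 < 2 ^ Suc m * d * M + 1" using d(1) M(1) by (intro add_nonneg_pos) auto
    show "scale P \<le> A" using P by simp
    fix k assume "P \<le> k"
    then have "h (scale k) \<le> 2 ^ Suc m * d * M / 2 ^ k" by (rule main)
    also have "\<dots> \<le> (2 ^ Suc m * d * M + 1) / 2 ^ k" by (intro divide_right_mono) auto
    finally show "h (scale k) \<le> (2 ^ Suc m * d * M + 1) / 2 ^ k" .
  qed
qed

text \<open>Positivity and finiteness correspond to the lower and the upper dyadic bound; the
  inequality between the two measures holds for every dimension function.\<close>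

lemma h_regular_iff_dyadic:
  assumes D: "(A, h) \<in> dim_funs"
  shows "h_regular (A, h) C \<longleftrightarrow> dyadic_gauge (A, h)"
proof
  assume reg: "h_regular (A, h) C"
  then have "0 < hausdorff_meas h C" "packing_meas h C < \<infinity>" by (auto simp: h_regular_def)
  obtain P c where 1: "0 < c" "scale P \<le> A" "\<And>k. P \<le> k \<Longrightarrow> c / 2 ^ k \<le> h (scale k)"
    using lower_bound_of_hausdorff_pos[OF D \<open>0 < hausdorff_meas h C\<close>] by blast
  obtain Q d where 2: "0 < d" "scale Q \<le> A" "\<And>k. Q \<le> k \<Longrightarrow> h (scale k) \<le> d / 2 ^ k"
    using upper_bound_of_packing_finite[OF D \<open>packing_meas h C < \<infinity>\<close>] by blast
  show "dyadic_gauge (A, h)" by (rule dyadic_gaugeI[OF 1(1) 2(1) 1(2) 2(2) 1(3) 2(3)])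
next
  assume "dyadic_gauge (A, h)"
  then obtain P c1 c2 where c: "0 < c1" "0 < c2" "scale P \<le> A"
    "\<And>k. P \<le> k \<Longrightarrow> c1 / 2 ^ k \<le> h (scale k)" "\<And>k. P \<le> k \<Longrightarrow> h (scale k) \<le> c2 / 2 ^ k"
    by (elim dyadic_gaugeE) blast
  have "0 < ennreal (c1 / 16)" using c(1) by simp
  also have "\<dots> \<le> hausdorff_content h (scale (P + 2)) C"
    by (rule hausdorff_content_cantor_pos[OF D c(1,3,4)])
  also have "\<dots> \<le> hausdorff_meas h C"
    unfolding hausdorff_meas_eq_SUP by (intro SUP_upper) (simp add: scale_pos)
  finally have "0 < hausdorff_meas h C" .
  moreover have "packing_meas h C \<le> ennreal (8 * c2)"
    using packing_meas_le_premeas packing_premeas_cantor_le[OF D c(2,3,5)] by (rule order_trans)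
  then have "packing_meas h C < \<infinity>" by (rule le_less_trans) simp
  ultimately show "h_regular (A, h) C"
    using hausdorff_meas_le_packing_meas[OF D] by (simp add: h_regular_def)
qed

end

theorem mainTheorem4:
  fixes a :: "nat \<Rightarrow> real" and x0 :: real
  assumes "\<And>n. 1 \<le> n \<Longrightarrow> 0 < a n"
    and "\<And>m n. 1 \<le> m \<Longrightarrow> m \<le> n \<Longrightarrow> a n \<le> a m"
    and "summable a"
  shows "(\<exists>h\<in>dim_funs. h_regular h (cantor_set a x0)) \<and>
    {h \<in> dim_funs. h_regular h (cantor_set a x0)} \<in> dim_funs // dim_fun_equiv \<and>
    (\<forall>h\<in>dim_funs. h_regular h (cantor_set a x0) \<longleftrightarrow> associated h a)"
proof -
  interpret cantor_construction a x0 by unfold_locales (fact assms)+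
  have reg: "h_regular h C \<longleftrightarrow> dyadic_gauge h" if "h \<in> dim_funs" for h
    using h_regular_iff_dyadic that by (cases h) blast
  have assoc: "associated h a \<longleftrightarrow> dyadic_gauge h" if "h \<in> dim_funs" for h
    using associated_iff_dyadic that by (cases h) blast
  \<comment> \<open>Once \<open>g\<close> is dyadic, the dimension functions equivalent to it are
    exactly the dyadic ones. With \<open>cantor_gauge\<close> as \<open>g\<close>, the regular ones
    form its class.\<close>
  have equiv: "gauge_le g h \<and> gauge_le h g \<longleftrightarrow> dyadic_gauge h"
    if "g \<in> dim_funs" "h \<in> dim_funs" "dyadic_gauge g" for g h
    using that dyadic_gauge_le dyadic_gauge_cong by (cases g, cases h) blast
  have "{h \<in> dim_funs. h_regular h C} = dim_fun_equiv `` {cantor_gauge}"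
    using equiv[OF cantor_gauge_dim_fun _ cantor_gauge_dyadic] reg cantor_gauge_dim_fun
    by (auto simp: dim_fun_equiv_def)
  then have "{h \<in> dim_funs. h_regular h C} \<in> dim_funs // dim_fun_equiv"
    using quotientI[OF cantor_gauge_dim_fun] by simp
  then show ?thesis
    using cantor_gauge_dim_fun cantor_gauge_dyadic reg assoc by blast
qed

end
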